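(* Let $G$ be a $2r$-regular graph of order $p$ with $r\ge 1$, $p\ge 3$, $p-2r\ge 2$ and $\chi(G)=\chi_{la}(G)$. Let $G_0=G$ and $G_{k+1}=G_k\vee O_{p-2r}$ for $k\ge 0$. Then $G_{k+1}$ is a $(2r+(k+1)(p-2r))$-regular graph of order $p+(k+1)(p-2r)$, and $\chi_{la}(G_k)=\chi_{la}(G)+k$ for all $k\ge 0$.
   Context: $O_n$ denotes the graph on $n$ vertices with no edges. For vertex-disjoint graphs $G,H$, the join $G\vee H$ has vertex set $V(G)\cup V(H)$ and edge set $E(G)\cup E(H)\cup\{uv: u\in V(G), v\in V(H)\}$; each $O_{p-2r}$ in the iteration is a fresh vertex-disjoint copy. $\chi$ is the chromatic number. For a simple graph with $q$ edges, a bijection $f:E\to\{1,\dots,q\}$ is a local antimagic labeling if $f^+(u)\neq f^+(v)$ for every edge $uv$, where $f^+(u)=\sum_{e\ni u} f(e)$; $\chi_{la}$ is the minimum number of distinct values of $f^+$ over all local antimagic labelings. *)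

theory Defs
  imports Main "HOL-Library.Extended_Nat"
begin

datatype 'a ugraph = UGraph (verts: "'a set") (edges: "'a set set")

definition simple_graph :: "'a ugraph \<Rightarrow> bool" where
  "simple_graph G \<longleftrightarrow> finite (verts G) \<and> (\<forall>e\<in>edges G. e \<subseteq> verts G \<and> card e = 2)"

definition graph_order :: "'a ugraph \<Rightarrow> nat" where
  "graph_order G = card (verts G)"

definition graph_degree :: "'a ugraph \<Rightarrow> 'a \<Rightarrow> nat" where
  "graph_degree G v = card {e \<in> edges G. v \<in> e}"

definition regular_graph :: "'a ugraph \<Rightarrow> nat \<Rightarrow> bool" where
  "regular_graph G d \<longleftrightarrow> (\<forall>v\<in>verts G. graph_degree G v = d)"

definition edgeless_graph :: "'a set \<Rightarrow> 'a ugraph" where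
  "edgeless_graph W = UGraph W {}"

text \<open>The join is only meant for graphs with disjoint vertex sets.\<close>

definition graph_join :: "'a ugraph \<Rightarrow> 'a ugraph \<Rightarrow> 'a ugraph" where
  "graph_join G H = UGraph (verts G \<union> verts H)
     (edges G \<union> edges H \<union> {{u, v} | u v. u \<in> verts G \<and> v \<in> verts H})"

definition proper_colouring :: "'a ugraph \<Rightarrow> ('a \<Rightarrow> nat) \<Rightarrow> bool" where
  "proper_colouring G c \<longleftrightarrow> (\<forall>u v. {u, v} \<in> edges G \<longrightarrow> c u \<noteq> c v)"

definition chromatic_number :: "'a ugraph \<Rightarrow> nat" where
  "chromatic_number G = (LEAST n. \<exists>c. proper_colouring G c \<and> c ` verts G \<subseteq> {..<n})"

definition vertex_sum :: "'a ugraph \<Rightarrow> ('a set \<Rightarrow> nat) \<Rightarrow> 'a \<Rightarrow> nat" where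
  "vertex_sum G f u = (\<Sum>e | e \<in> edges G \<and> u \<in> e. f e)"

definition local_antimagic :: "'a ugraph \<Rightarrow> ('a set \<Rightarrow> nat) \<Rightarrow> bool" where
  "local_antimagic G f \<longleftrightarrow> bij_betw f (edges G) {1..card (edges G)} \<and>
     (\<forall>u v. {u, v} \<in> edges G \<longrightarrow> vertex_sum G f u \<noteq> vertex_sum G f v)"

text \<open>The value is \<open>\<infinity>\<close> exactly when \<open>G\<close> has no local antimagic labeling;
  otherwise the infimum is attained.\<close>

definition chi_la :: "'a ugraph \<Rightarrow> enat" where
  "chi_la G = (INF f \<in> {f. local_antimagic G f}. enat (card (vertex_sum G f ` verts G)))"

text \<open>Over an infinite vertex type, fresh disjoint copies of the edgeless graph are always
  available, so iterated joins exist.\<close>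

lemma iterated_join_exists:
  fixes G :: "'a ugraph"
  assumes inf: "infinite (UNIV :: 'a set)" and fin: "finite (verts G)"
  shows "\<exists>Gs W. Gs 0 = G \<and> (\<forall>k. finite (W k) \<and> card (W k) = n \<and> W k \<inter> verts (Gs k) = {} \<and>
           Gs (Suc k) = graph_join (Gs k) (edgeless_graph (W k)))"
proof -
  have "infinite (UNIV - verts G)" using inf fin by simp
  then obtain f :: "nat \<Rightarrow> 'a" where f: "inj f" "range f \<subseteq> UNIV - verts G"
    using infinite_countable_subset by blast
  define W where "W k = f ` {k * n..<k * n + n}" for k
  define Gs where "Gs = rec_nat G (\<lambda>k H. graph_join H (edgeless_graph (W k)))"
  have Gs: "Gs 0 = G" "Gs (Suc k) = graph_join (Gs k) (edgeless_graph (W k))" for k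
    by (simp_all add: Gs_def)
  have V: "verts (Gs k) = verts G \<union> f ` {..<k * n}" for k
  proof (induction k)
    case (Suc k)
    have "{..<Suc k * n} = {..<k * n} \<union> {k * n..<k * n + n}" by auto
    then show ?case using Suc by (simp add: Gs graph_join_def edgeless_graph_def W_def image_Un Un_assoc)
  qed (simp add: Gs)
  have "finite (W k) \<and> card (W k) = n \<and> W k \<inter> verts (Gs k) = {}" for k
  proof (intro conjI)
    show "card (W k) = n"
      unfolding W_def by (subst card_image) (use f(1) in \<open>auto intro: inj_on_subset\<close>)
    show "W k \<inter> verts (Gs k) = {}"
      unfolding V W_def using f by (fastforce simp: inj_def)
  qed (simp add: W_def)
  with Gs show ?thesis by blast
qed

end

theory Submission
  imports Defs
begin

text \<open>If \<open>G\<close> has \<open>n\<close> vertices and is regular of even degree \<open>d = n - m\<close>, shift a local antimagic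
  labelling of \<open>G\<close> above \<open>1, \<dots>, n m\<close> and put a magic rectangle on the \<open>n \<times> m\<close> new edges: all old
  vertex sums grow by the same amount and exceed the common sum of the new vertices, so exactly
  one colour is added.  For odd \<open>m\<close> the parities of \<open>n\<close> and \<open>m\<close> agree only at every second
  join, and two joins are performed together.  The lower bound is
  \<open>\<chi>(G) + k \<le> \<chi>(G\<^sub>k) \<le> \<chi>\<^sub>l\<^sub>a(G\<^sub>k)\<close>.

  Magic rectangles are built as arrays of signed numbers with vanishing row and column sums.
  Most columns come in pairs \<open>g, -g\<close>, so that only the sum of \<open>g\<close> matters; in the odd case
  three columns remain, and all entries are written \<open>a m + b\<close> with balanced digits \<open>a, b\<close>.\<close>

section \<open>Zero-sum arrays and magic rectangles\<close>

text \<open>The array is a list of columns indexed by \<open>I\<close>. Only covering of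
  \<open>S\<close> is demanded, which makes the notion monotone in \<open>S\<close> and stable under
  concatenation; that no value repeats follows later by counting cells.\<close>

definition zero_sum_array :: "'i set \<Rightarrow> nat \<Rightarrow> int set \<Rightarrow> bool" where
  "zero_sum_array I k S \<longleftrightarrow> (\<exists>cs :: ('i \<Rightarrow> int) list. length cs = k \<and>
     (\<forall>c\<in>set cs. sum c I = 0) \<and> (\<forall>i\<in>I. (\<Sum>c\<leftarrow>cs. c i) = 0) \<and>
     S \<subseteq> (\<Union>c\<in>set cs. c ` I))"

lemma zero_sum_array_mono:
  "zero_sum_array I k S \<Longrightarrow> T \<subseteq> S \<Longrightarrow> zero_sum_array I k T"
  unfolding zero_sum_array_def by (elim exE, rule exI) auto

lemma zero_sum_array_append:
  assumes "zero_sum_array I k S" and "zero_sum_array I l T"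
  shows "zero_sum_array I (k + l) (S \<union> T)"
proof -
  from assms obtain cs ds where
    "length cs = k" "\<forall>c\<in>set cs. sum c I = 0" "\<forall>i\<in>I. (\<Sum>c\<leftarrow>cs. c i) = 0"
    "S \<subseteq> (\<Union>c\<in>set cs. c ` I)"
    "length ds = l" "\<forall>c\<in>set ds. sum c I = 0" "\<forall>i\<in>I. (\<Sum>c\<leftarrow>ds. c i) = 0"
    "T \<subseteq> (\<Union>c\<in>set ds. c ` I)"
    unfolding zero_sum_array_def by blast
  then show ?thesis
    unfolding zero_sum_array_def by (intro exI[of _ "cs @ ds"]) auto
qed

lemma zero_sum_array_pair:
  assumes "sum g I = 0" and "\<And>x. x \<in> S \<Longrightarrow> \<exists>i\<in>I. x = g i \<or> x = - g i"
  shows "zero_sum_array I 2 S"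
  unfolding zero_sum_array_def
proof (intro exI[of _ "[g, \<lambda>i. - g i]"] conjI)
  show "S \<subseteq> (\<Union>c\<in>set [g, \<lambda>i. - g i]. c ` I)" using assms(2) by fastforce
qed (use assms(1) in \<open>auto simp: sum_negf\<close>)

lemma zero_sum_array_scale:
  assumes "zero_sum_array I k S"
  shows "zero_sum_array I k ((*) c ` S)"
proof -
  from assms obtain cs where cs:
    "length cs = k" "\<forall>c\<in>set cs. sum c I = 0" "\<forall>i\<in>I. (\<Sum>c\<leftarrow>cs. c i) = 0"
    "S \<subseteq> (\<Union>c\<in>set cs. c ` I)"
    unfolding zero_sum_array_def by blast
  show ?thesis
    unfolding zero_sum_array_def
  proof (intro exI[of _ "map (\<lambda>g i. c * g i) cs"] conjI)
    show "\<forall>g\<in>set (map (\<lambda>g i. c * g i) cs). sum g I = 0"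
      using cs(2) by (auto simp flip: sum_distrib_left)
    show "\<forall>i\<in>I. (\<Sum>g\<leftarrow>map (\<lambda>g i. c * g i) cs. g i) = 0"
      using cs(3) by (simp add: o_def sum_list_const_mult)
    show "(*) c ` S \<subseteq> (\<Union>g\<in>set (map (\<lambda>g i. c * g i) cs). g ` I)"
      using cs(4) by fastforce
  qed (use cs(1) in simp)
qed

text \<open>Line sums are doubled so that the magic constants involve no division by 2.\<close>

definition magic_rectangle :: "'a set \<Rightarrow> 'b set \<Rightarrow> ('a \<Rightarrow> 'b \<Rightarrow> nat) \<Rightarrow> bool" where
  "magic_rectangle V W L \<longleftrightarrow>
     bij_betw (\<lambda>(v, w). L v w) (V \<times> W) {1..card V * card W} \<and>
     (\<forall>v\<in>V. 2 * (\<Sum>w\<in>W. L v w) = card W * (card V * card W + 1)) \<and>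
     (\<forall>w\<in>W. 2 * (\<Sum>v\<in>V. L v w) = card V * (card V * card W + 1))"

text \<open>\<open>2 * int k - int N - 1\<close> is twice the deviation of \<open>k\<close> from the
  mean of \<open>{1..N}\<close>, so that magic line sums turn into zero sums.\<close>

lemma bij_betw_centred:
  "bij_betw (\<lambda>k. 2 * int k - int N - 1) {1..N} {x. \<bar>x\<bar> < int N \<and> odd (x + int N)}"
proof (rule bij_betw_imageI)
  show "inj_on (\<lambda>k. 2 * int k - int N - 1) {1..N}" by (auto simp: inj_on_def)
  show "(\<lambda>k. 2 * int k - int N - 1) ` {1..N} = {x. \<bar>x\<bar> < int N \<and> odd (x + int N)}"
  proof (intro set_eqI iffI)
    fix x assume x: "x \<in> {x. \<bar>x\<bar> < int N \<and> odd (x + int N)}"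
    then obtain y where y: "x + int N = 2 * y + 1" using oddE by blast
    then have "x = 2 * int (nat (y + 1)) - int N - 1" "nat (y + 1) \<in> {1..N}" using x by auto
    then show "x \<in> (\<lambda>k. 2 * int k - int N - 1) ` {1..N}" by blast
  qed auto
qed

text \<open>The array has \<open>N\<close> cells and covers \<open>N\<close> centred values, hence
  it takes each of them exactly once. Undoing the centring turns the zero sums into the magic
  constants.\<close>

lemma magic_rectangle_if_zero_sum_array:
  fixes V :: "'a set" and W :: "'b set" and I :: "'i set"
  assumes fin: "finite V" "finite W" "finite I" and card: "card V = card I"
    and arr: "zero_sum_array I (card W) {x. \<bar>x\<bar> < int N \<and> odd (x + int N)}"
    and N: "N = card V * card W"
  shows "\<exists>L. magic_rectangle V W L"
proof -
  let ?T = "{x. \<bar>x\<bar> < int N \<and> odd (x + int N)}"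
  obtain cs where cs: "length cs = card W" "\<And>c. c \<in> set cs \<Longrightarrow> sum c I = 0"
    "\<And>i. i \<in> I \<Longrightarrow> (\<Sum>c\<leftarrow>cs. c i) = 0" "?T \<subseteq> (\<Union>c\<in>set cs. c ` I)"
    using arr unfolding zero_sum_array_def by blast
  obtain \<phi> where \<phi>: "bij_betw \<phi> V I"
    using fin card finite_same_card_bij by blast
  obtain \<psi> where \<psi>: "bij_betw \<psi> W {..<card W}"
    using fin(2) bij_betw_iff_card[of W "{..<card W}"] by auto
  define X where "X v w = (cs ! \<psi> w) (\<phi> v)" for v w
  have cardT: "card ?T = N"
    using bij_betw_same_card[OF bij_betw_centred[of N]] by simp
  have sub: "?T \<subseteq> (\<lambda>(v, w). X v w) ` (V \<times> W)"
  proof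
    fix x assume "x \<in> ?T"
    then obtain c i where ci: "c \<in> set cs" "i \<in> I" "x = c i" using cs(4) by blast
    then obtain j where "j < card W" "c = cs ! j" using cs(1) by (metis in_set_conv_nth)
    then obtain w where "w \<in> W" "\<psi> w = j" using \<psi> by (metis bij_betw_iff_bijections lessThan_iff)
    moreover obtain v where "v \<in> V" "\<phi> v = i" using \<phi> ci by (metis bij_betw_iff_bijections)
    ultimately show "x \<in> (\<lambda>(v, w). X v w) ` (V \<times> W)"
      using ci \<open>c = cs ! j\<close> by (force simp: X_def)
  qed
  have le: "card ((\<lambda>(v, w). X v w) ` (V \<times> W)) \<le> N"
    using card_image_le[of "V \<times> W"] fin N by (metis card_cartesian_product finite_cartesian_product)
  have im: "(\<lambda>(v, w). X v w) ` (V \<times> W) = ?T"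
    using card_seteq[OF _ sub] le cardT fin by simp
  have inj: "inj_on (\<lambda>(v, w). X v w) (V \<times> W)"
    by (rule eq_card_imp_inj_on) (use fin im cardT N in \<open>simp_all add: card_cartesian_product\<close>)
  \<comment> \<open>This inverts the centring; the division is exact because of the parity of the
    entries.\<close>
  define L where "L v w = nat ((X v w + int N + 1) div 2)" for v w
  have XL: "2 * int (L v w) = X v w + int N + 1" if "v \<in> V" "w \<in> W" for v w
  proof -
    have "X v w \<in> ?T" using im that by (auto simp: image_iff)
    then have "even (X v w + int N + 1)" "0 \<le> X v w + int N + 1" by auto
    then show ?thesis unfolding L_def by (elim evenE) simp
  qed
  have "bij_betw (\<lambda>(v, w). L v w) (V \<times> W) {1..N}"
  proof (rule bij_betw_imageI)
    show "inj_on (\<lambda>(v, w). L v w) (V \<times> W)"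
    proof (rule inj_onI, clarsimp)
      fix a b c d assume h: "a \<in> V" "b \<in> W" "c \<in> V" "d \<in> W" "L a b = L c d"
      then have "X a b = X c d" using XL[of a b] XL[of c d] by simp
      then show "a = c \<and> b = d" using inj h by (auto simp: inj_on_def)
    qed
    show "(\<lambda>(v, w). L v w) ` (V \<times> W) = {1..N}"
    proof (intro set_eqI iffI)
      fix k assume "k \<in> (\<lambda>(v, w). L v w) ` (V \<times> W)"
      then obtain v w where vw: "v \<in> V" "w \<in> W" "k = L v w" by auto
      then have "X v w \<in> ?T" using im by (auto simp: image_iff)
      then show "k \<in> {1..N}" using XL[OF vw(1,2)] vw(3) by auto
    next
      fix k assume "k \<in> {1..N}"
      then have "2 * int k - int N - 1 \<in> ?T" using bij_betw_centred[of N] by (auto simp: bij_betw_def)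
      then have "2 * int k - int N - 1 \<in> (\<lambda>(v, w). X v w) ` (V \<times> W)" using im by simp
      then obtain v w where vw: "v \<in> V" "w \<in> W" "2 * int k - int N - 1 = X v w" by auto
      then have "k = L v w" using XL[OF vw(1,2)] by simp
      then show "k \<in> (\<lambda>(v, w). L v w) ` (V \<times> W)" using vw by force
    qed
  qed
  moreover have "2 * (\<Sum>w\<in>W. L v w) = card W * (N + 1)" if v: "v \<in> V" for v
  proof -
    have "(\<Sum>w\<in>W. X v w) = (\<Sum>j<card W. (cs ! j) (\<phi> v))"
      unfolding X_def by (rule sum.reindex_bij_betw[OF \<psi>])
    also have "\<dots> = (\<Sum>c\<leftarrow>cs. c (\<phi> v))"
      using cs(1) by (simp add: sum_list_sum_nth atLeast0LessThan)
    also have "\<dots> = 0" using cs(3) \<phi> v by (meson bij_betwE)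
    finally have "(\<Sum>w\<in>W. X v w) = 0" .
    have "int (2 * (\<Sum>w\<in>W. L v w)) = (\<Sum>w\<in>W. X v w + int N + 1)"
      using XL[OF v] by (simp add: sum_distrib_left)
    also have "\<dots> = int (card W * (N + 1))"
      using \<open>(\<Sum>w\<in>W. X v w) = 0\<close> by (simp add: sum.distrib algebra_simps)
    finally show ?thesis by (simp only: of_nat_eq_iff)
  qed
  moreover have "2 * (\<Sum>v\<in>V. L v w) = card V * (N + 1)" if w: "w \<in> W" for w
  proof -
    have "(\<Sum>v\<in>V. X v w) = sum (cs ! \<psi> w) I"
      unfolding X_def by (rule sum.reindex_bij_betw[OF \<phi>])
    also have "\<dots> = 0" using cs(1,2) \<psi> w by (metis bij_betwE lessThan_iff nth_mem)
    finally have "(\<Sum>v\<in>V. X v w) = 0" .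
    have "int (2 * (\<Sum>v\<in>V. L v w)) = (\<Sum>v\<in>V. X v w + int N + 1)"
      using XL[OF _ w] by (simp add: sum_distrib_left)
    also have "\<dots> = int (card V * (N + 1))"
      using \<open>(\<Sum>v\<in>V. X v w) = 0\<close> by (simp add: sum.distrib algebra_simps)
    finally show ?thesis by (simp only: of_nat_eq_iff)
  qed
  ultimately show ?thesis
    unfolding magic_rectangle_def N by blast
qed

section \<open>Even sides\<close>

text \<open>Rows \<open>2 * t\<close> and \<open>2 * t + 1\<close> carry the same magnitude with
  opposite signs.\<close>

lemma sum_alternating_pairs:
  fixes c k :: int
  assumes "even n"
  shows "(\<Sum>i<n. (-1) ^ i * (c + 8 * int (i div 2) + k)) = 0"
proof -
  have "(\<Sum>i<2 * t. (-1) ^ i * (c + 8 * int (i div 2) + k)) = 0" for t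
    by (induction t) simp_all
  then show ?thesis using assms by (auto elim: evenE)
qed

text \<open>A \<open>2 \<times> 4\<close> block with rows \<open>\<plusminus>(x, -(x + 2), -(x + 4), x + 6)\<close>, repeated downwards.\<close>

lemma zero_sum_array_four_columns:
  fixes c :: int
  assumes "even n"
  shows "zero_sum_array {..<n} 4 {x. \<exists>u<2 * n. \<bar>x\<bar> = c + 2 * int u}"
proof -
  define col where "col s k i = s * ((-1) ^ i * (c + 8 * int (i div 2) + k))" for s k :: int and i :: nat
  let ?cs = "[col 1 0, col (-1) 2, col (-1) 4, col 1 6]"
  have "sum (col s k) {..<n} = 0" for s k
    unfolding col_def sum_distrib_left[symmetric] using sum_alternating_pairs[OF assms, of c] by simp
  then have "sum g {..<n} = 0" if "g \<in> set ?cs" for g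
    using that by auto
  moreover have "(\<Sum>g\<leftarrow>?cs. g i) = 0" for i
    by (simp add: col_def algebra_simps)
  moreover have "{x. \<exists>u<2 * n. \<bar>x\<bar> = c + 2 * int u} \<subseteq> (\<Union>g\<in>set ?cs. g ` {..<n})"
  proof clarify
    fix x u assume u: "u < 2 * n" "\<bar>x\<bar> = c + 2 * int u"
    \<comment> \<open>The quotient of \<open>u\<close> by 4 selects the pair of rows, the remainder
      selects the column.\<close>
    define t where "t = u div 4"
    obtain b where b: "n = 2 * b" using assms by (elim evenE)
    have "t < b" using u(1) unfolding t_def b by (simp add: less_mult_imp_div_less)
    then have t: "2 * t < n" "2 * t + 1 < n" using b by simp_all
    have pm: "x \<in> col s k ` {..<n}" if "\<bar>x\<bar> = c + 8 * int t + k" "s = 1 \<or> s = -1" for s k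
    proof -
      have "x = col s k (2 * t) \<or> x = col s k (2 * t + 1)"
        using that by (auto simp: col_def abs_if split: if_splits)
      then show ?thesis using t by auto
    qed
    have "u = 4 * t + u mod 4" "u mod 4 < 4" by (simp_all add: t_def)
    then have "\<bar>x\<bar> = c + 8 * int t + 2 * int (u mod 4)" using u(2) by linarith
    moreover have "u mod 4 = 0 \<or> u mod 4 = 1 \<or> u mod 4 = 2 \<or> u mod 4 = 3" by linarith
    ultimately show "x \<in> (\<Union>g\<in>set ?cs. g ` {..<n})"
      using pm[of 0 1] pm[of 2 "-1"] pm[of 4 "-1"] pm[of 6 1] by auto
  qed
  ultimately show ?thesis
    unfolding zero_sum_array_def by (intro exI[of _ ?cs]) simp
qed

text \<open>Four consecutive odd numbers cancel with signs +, -, -, +, so the cases 4 and 6 extend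
  in steps of 4. For \<open>n = 2\<close> the claim fails, since 1 and 3 cannot cancel.\<close>

lemma signed_sum_odd_numbers_zero:
  assumes "even n" "n \<ge> 4"
  shows "\<exists>s :: nat \<Rightarrow> int. (\<forall>i. s i = 1 \<or> s i = -1) \<and> (\<Sum>i<n. s i * (2 * int i + 1)) = 0"
  using assms
proof (induction n rule: less_induct)
  case (less n)
  consider "n = 4" | "n = 6" | "n \<ge> 8"
    using less.prems by (cases "n = 5 \<or> n = 7") (auto, linarith)
  then show ?case
  proof cases
    case 1
    then show ?thesis
      by (intro exI[of _ "\<lambda>i. if i \<in> {1, 2} then -1 else 1"]) (simp add: eval_nat_numeral)
  next
    case 2
    then show ?thesis
      by (intro exI[of _ "\<lambda>i. if i \<in> {3, 5} then -1 else 1"]) (simp add: eval_nat_numeral)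
  next
    case 3
    then have "n - 4 < n" "even (n - 4)" "n - 4 \<ge> 4" using less.prems by auto
    then obtain s :: "nat \<Rightarrow> int" where s: "\<forall>i. s i = 1 \<or> s i = -1"
      "(\<Sum>i<n - 4. s i * (2 * int i + 1)) = 0"
      using less.IH by blast
    define k where "k = n - 4"
    have n: "n = Suc (Suc (Suc (Suc k)))" using 3 by (simp add: k_def)
    let ?s = "\<lambda>i. if i < k then s i else if i \<in> {k + 1, k + 2} then -1 else 1"
    have "(\<Sum>i<k. ?s i * (2 * int i + 1)) = 0"
      using s(2) by (simp add: k_def)
    then have "(\<Sum>i<n. ?s i * (2 * int i + 1)) = 0"
      by (simp add: n)
    then show ?thesis using s(1) by (intro exI[of _ ?s]) auto
  qed
qed

text \<open>Four columns are added at a time, starting from none or from two. The two starting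
  columns are \<open>g\<close> and \<open>-g\<close>, where \<open>g\<close> is a signed list of the
  first \<open>n\<close> odd numbers with sum zero.\<close>

lemma zero_sum_array_even:
  assumes n: "even n" "n \<ge> 4" and m: "even m"
  shows "zero_sum_array {..<n} m {x. \<bar>x\<bar> < int (n * m) \<and> odd (x + int (n * m))}"
proof -
  let ?S = "\<lambda>m. {x. \<bar>x\<bar> < int (n * m) \<and> odd (x + int (n * m))}"
  have step: "zero_sum_array {..<n} (m + 4) (?S (m + 4))" if "zero_sum_array {..<n} m (?S m)" for m
  proof (rule zero_sum_array_mono)
    \<comment> \<open>The shell of new values, with magnitudes \<open>n * m + 1\<close>,
      \<open>n * m + 3\<close>, up to \<open>n * (m + 4) - 1\<close>.\<close>
    let ?T = "{x. \<exists>u<2 * n. \<bar>x\<bar> = int (n * m) + 1 + 2 * int u}"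
    show "zero_sum_array {..<n} (m + 4) (?S m \<union> ?T)"
      by (intro zero_sum_array_append that zero_sum_array_four_columns n)
    have "x \<in> ?S m" if x: "\<bar>x\<bar> < int (n * (m + 4))" "odd (x + int (n * (m + 4)))" "x \<notin> ?T" for x
    proof -
      have odd: "odd x" "even (int (n * m))" using x(2) n by auto
      then have odd': "odd (x + int (n * m))" by simp
      have "\<bar>x\<bar> < int (n * m)"
      proof (rule ccontr)
        assume "\<not> \<bar>x\<bar> < int (n * m)"
        moreover have "even (\<bar>x\<bar> - int (n * m) - 1)" using odd by simp
        then obtain y where "\<bar>x\<bar> - int (n * m) - 1 = 2 * y" by (elim evenE)
        ultimately have "\<bar>x\<bar> = int (n * m) + 1 + 2 * int (nat y)" "nat y < 2 * n"
          using x(1) by (auto simp: algebra_simps)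
        then show False using x(3) by blast
      qed
      then show ?thesis using odd' by simp
    qed
    then show "?S (m + 4) \<subseteq> ?S m \<union> ?T" by blast
  qed
  have base0: "zero_sum_array {..<n} 0 (?S 0)"
    unfolding zero_sum_array_def by auto
  have base2: "zero_sum_array {..<n} 2 (?S 2)"
  proof -
    obtain s :: "nat \<Rightarrow> int" where s: "\<forall>i. s i = 1 \<or> s i = -1"
      "(\<Sum>i<n. s i * (2 * int i + 1)) = 0"
      using signed_sum_odd_numbers_zero[OF n] by blast
    show ?thesis
    proof (rule zero_sum_array_pair[OF s(2)])
      fix x assume x: "x \<in> ?S 2"
      then have "odd \<bar>x\<bar>" by simp
      then obtain y where y: "\<bar>x\<bar> = 2 * y + 1" by (elim oddE)
      then have "nat y < n" "\<bar>x\<bar> = 2 * int (nat y) + 1" using x by auto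
      then show "\<exists>i\<in>{..<n}. x = s i * (2 * int i + 1) \<or> x = - (s i * (2 * int i + 1))"
        using s(1) by (intro bexI[of _ "nat y"]) (auto simp: abs_if split: if_splits, (metis mult_1 mult_minus_left minus_minus)+)
    qed
  qed
  have gen: "zero_sum_array {..<n} (m0 + 4 * t) (?S (m0 + 4 * t))" if "m0 = 0 \<or> m0 = 2" for m0 t
  proof (induction t)
    case 0
    then show ?case using base0 base2 that by auto
  next
    case (Suc t)
    have "m0 + 4 * Suc t = m0 + 4 * t + 4" by simp
    then show ?case using step[OF Suc] by (simp only:)
  qed
  have "m mod 4 = 0 \<or> m mod 4 = 2" using m by presburger
  then have "m mod 4 + 4 * (m div 4) = m \<and> (m mod 4 = 0 \<or> m mod 4 = 2)" by simp
  then show ?thesis using gen[of "m mod 4" "m div 4"] by (simp only:)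
qed

section \<open>Odd sides\<close>

text \<open>Multiplication by a unit followed by a translation permutes the residues modulo
  \<open>n\<close>.\<close>

lemma sum_affine_mod:
  fixes k n c :: int
  assumes "coprime k n" "n > 0"
  shows "(\<Sum>i\<in>{0..<n}. (k * i + c) mod n) = \<Sum>{0..<n}"
proof -
  have "inj_on (\<lambda>i. (k * i + c) mod n) {0..<n}"
  proof (rule inj_onI)
    fix i j assume ij: "i \<in> {0..<n}" "j \<in> {0..<n}" "(k * i + c) mod n = (k * j + c) mod n"
    then have "n dvd (k * i + c) - (k * j + c)" by (simp add: mod_eq_dvd_iff)
    then have "n dvd k * (i - j)" by (simp add: algebra_simps)
    then have "n dvd i - j" using assms(1) by (simp add: coprime_commute coprime_dvd_mult_right_iff)
    then have "i mod n = j mod n" by (simp add: mod_eq_dvd_iff)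
    then show "i = j" using ij by simp
  qed
  moreover have "(\<lambda>i. (k * i + c) mod n) ` {0..<n} \<subseteq> {0..<n}" using assms(2) by auto
  ultimately have "bij_betw (\<lambda>i. (k * i + c) mod n) {0..<n} {0..<n}"
    using endo_inj_surj[of "{0..<n}"] by (auto simp: bij_betw_def)
  then show ?thesis by (rule sum.reindex_bij_betw)
qed

text \<open>The bound equals \<open>((2 * H + 1) * (2 * h + 1) - 1) / 2\<close>, so the range has
  exactly as many integers as there are digit pairs. The digits come from dividing
  \<open>x + h\<close> by \<open>2 * h + 1\<close>.\<close>

lemma balanced_digits:
  fixes x :: int
  assumes "\<bar>x\<bar> \<le> 2 * int H * int h + int H + int h"
  obtains a b where "x = a * (2 * int h + 1) + b" "\<bar>a\<bar> \<le> int H" "\<bar>b\<bar> \<le> int h"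
proof
  let ?m = "2 * int h + 1"
  show "x = ((x + int h) div ?m) * ?m + ((x + int h) mod ?m - int h)"
    using div_mult_mod_eq[of "x + int h" ?m] by linarith
  have "0 \<le> (x + int h) mod ?m" "(x + int h) mod ?m < ?m"
    using pos_mod_sign[of ?m] pos_mod_bound[of ?m] by simp_all
  then show "\<bar>(x + int h) mod ?m - int h\<bar> \<le> int h" by linarith
  have "x + int h < (int H + 1) * ?m" "- int H * ?m \<le> x + int h"
    using assms by (simp_all add: algebra_simps abs_le_iff)
  then have "(x + int h) div ?m * ?m < (int H + 1) * ?m" "- int H * ?m < ((x + int h) div ?m + 1) * ?m"
    using div_mult_mod_eq[of "x + int h" ?m] pos_mod_sign[of ?m "x + int h"] pos_mod_bound[of ?m "x + int h"]
    unfolding distrib_right mult_1 by linarith+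
  then have "(x + int h) div ?m < int H + 1" "- int H < (x + int h) div ?m + 1"
    by (simp_all only: mult_less_cancel_right)
  then show "\<bar>(x + int h) div ?m\<bar> \<le> int H" by linarith
qed

text \<open>Two orthogonal Latin squares over \<open>\<int>/n\<close> give the digits in base \<open>n\<close>.\<close>

lemma zero_sum_array_odd_square:
  fixes h :: nat
  defines "n \<equiv> 2 * int h + 1"
  shows "zero_sum_array {0..<n} (2 * h + 1) {x. \<bar>x\<bar> \<le> 2 * int h * int h + int h + int h}"
proof -
  define A where "A j i = n * ((i + j) mod n - int h) + ((2 * i + j) mod n - int h)" for i j
  define cs where "cs = map A [0..n - 1]"
  have n: "n > 0" "odd n" by (simp_all add: n_def)
  have tot: "(\<Sum>i\<in>{0..<n}. i - int h) = 0"
  proof -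
    have "\<Sum>{0..<int k} * 2 = int k * (int k - 1)" for k
    proof (induction k)
      case (Suc k)
      have "{0..<int (Suc k)} = insert (int k) {0..<int k}" by auto
      then show ?case using Suc by (simp add: algebra_simps)
    qed simp
    from this[of "2 * h + 1"] have "\<Sum>{0..<n} = n * int h" by (simp add: n_def algebra_simps)
    then show ?thesis using n(1) by (simp add: sum_subtractf)
  qed
  have aff: "(\<Sum>i\<in>{0..<n}. (k * i + c) mod n - int h) = 0" if "coprime k n" for k c
    using sum_affine_mod[OF that n(1), of c] tot by (simp add: sum_subtractf)
  have cols: "sum (A j) {0..<n} = 0" for j
  proof -
    \<comment> \<open>Down a column the digits are affine in \<open>i\<close> with coefficients 1
      and 2; oddness of \<open>n\<close> makes 2 a unit. Along a row both coefficients of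
      \<open>j\<close> are 1.\<close>
    have "coprime 2 n" using n(2) by simp
    then show ?thesis unfolding A_def sum.distrib sum_distrib_left[symmetric]
      using aff[of 1 j] aff[of 2 j] by simp
  qed
  have rows: "(\<Sum>j\<in>{0..<n}. A j i) = 0" for i
    unfolding A_def sum.distrib sum_distrib_left[symmetric]
    using aff[of 1 i] aff[of 1 "2 * i"] by (simp add: add.commute)
  have cover: "{x. \<bar>x\<bar> \<le> 2 * int h * int h + int h + int h} \<subseteq> (\<Union>c\<in>set cs. c ` {0..<n})"
  proof
    fix x assume "x \<in> {x. \<bar>x\<bar> \<le> 2 * int h * int h + int h + int h}"
    then obtain a b where ab: "x = a * n + b" "\<bar>a\<bar> \<le> int h" "\<bar>b\<bar> \<le> int h"
      unfolding n_def using balanced_digits[of x h h] by auto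
    \<comment> \<open>The solution of \<open>i + j = a + h\<close> and
      \<open>2 * i + j = b + h\<close> modulo \<open>n\<close>.\<close>
    let ?i = "(b - a) mod n" and ?j = "(2 * a - b + int h) mod n"
    have "(?i + ?j) mod n = (b - a + (2 * a - b + int h)) mod n" by (simp add: mod_simps)
    also have "\<dots> = a + int h" using ab(2) by (simp add: n_def)
    finally have 1: "(?i + ?j) mod n = a + int h" .
    have "(2 * ?i + ?j) mod n = (2 * (b - a) + (2 * a - b + int h)) mod n"
      by (metis mod_add_left_eq mod_add_right_eq mod_mult_right_eq)
    also have "\<dots> = b + int h" using ab(3) by (simp add: n_def)
    finally have 2: "(2 * ?i + ?j) mod n = b + int h" .
    have "x = A ?j ?i" using 1 2 ab(1) by (simp add: A_def)
    moreover have "?i \<in> {0..<n}" "A ?j \<in> set cs" using n(1) by (simp_all add: cs_def)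
    ultimately show "x \<in> (\<Union>c\<in>set cs. c ` {0..<n})" by blast
  qed
  have "(\<Sum>c\<leftarrow>cs. c i) = 0" for i
  proof -
    have "(\<Sum>c\<leftarrow>cs. c i) = (\<Sum>j\<leftarrow>[0..n - 1]. A j i)" unfolding cs_def map_map o_def ..
    also have "\<dots> = (\<Sum>j\<in>{0..n - 1}. A j i)"
      by (simp only: sum_list_distinct_conv_sum_set[OF distinct_upto] set_upto)
    also have "{0..n - 1} = {0..<n}" by auto
    finally show ?thesis using rows[of i] by (rule trans)
  qed
  then show ?thesis
    unfolding zero_sum_array_def
  proof (intro exI[of _ cs] conjI)
    show "length cs = 2 * h + 1" by (simp add: cs_def n_def)
    show "\<forall>c\<in>set cs. sum c {0..<n} = 0" using cols by (simp add: cs_def)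
    show "{x. \<bar>x\<bar> \<le> 2 * int h * int h + int h + int h} \<subseteq> (\<Union>c\<in>set cs. c ` {0..<n})"
      by (fact cover)
  qed simp
qed

section \<open>Odd sides of different lengths\<close>

lemma sum_symmetric_interval:
  fixes g :: "int \<Rightarrow> int"
  assumes "H \<ge> 0"
  shows "sum g {-H..H} = g 0 + (\<Sum>d\<in>{1..H}. g d + g (- d))"
proof -
  have "{-H..H} = {0} \<union> {1..H} \<union> uminus ` {1..H}" (is "_ = ?A \<union> ?B \<union> ?C")
    using assms by (auto simp: image_iff)
  moreover have "sum g (?A \<union> ?B \<union> ?C) = sum g ?A + sum g ?B + sum g ?C"
    by (subst sum.union_disjoint; (subst sum.union_disjoint)?) auto
  moreover have "sum g ?C = (\<Sum>d\<in>{1..H}. g (- d))"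
    by (subst sum.reindex) (auto simp: inj_on_def)
  ultimately show ?thesis by (simp add: sum.distrib)
qed

text \<open>Over the digits \<open>(a, e)\<close> every row is
  \<open>(d, 0), ((C - d) / 2, 1), ((-C - d) / 2, -1)\<close>, where \<open>C\<close> depends on the parity of \<open>d\<close>
  so that \<open>(C - d) / 2\<close> runs through \<open>-H, \<dots>, H\<close>.  The rows \<open>d\<close> and \<open>-d\<close> are
  negatives of each other, so their columns cancel; the row \<open>d = 0\<close> is absorbed by a
  rearrangement of the seven rows with \<open>\<bar>d\<bar> \<le> 3\<close>.\<close>

lemma zero_sum_array_three_columns:
  fixes H m \<alpha> :: int
  assumes H: "H \<ge> 3"
  shows "zero_sum_array {-H..H} 3 {x. \<exists>a e. \<bar>a\<bar> \<le> H \<and> e \<in> {-1, 0, 1} \<and> x = a * m + e * \<alpha>}"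
proof -
  define k where "k = H div 2"
  define C where "C d = (if even d then 2 * k - 2 * H else 2 * k + 1)" for d :: int
  define s where "s d = (if d < 0 then -1 else 1 :: int)" for d :: int
  \<comment> \<open>\<open>E d\<close> lists, column by column, the low digits \<open>e\<close> in
    row \<open>d\<close>. The default is opposite for \<open>d\<close> and \<open>-d\<close>; the
    exceptions lie within the seven middle rows.\<close>
  define E where "E d = (if d \<in> {-1, -2, 3} then [s d, 0, - s d]
    else if d = 0 then [s d, - s d, 0] else [0, s d, - s d])" for d
  define val where "val d e = (if e = 0 then d * m else (e * C d - d) div 2 * m + e * \<alpha>)" for d e
  \<comment> \<open>\<open>w\<close> is twice \<open>val\<close>, so that column and row sums can be
    computed without halving.\<close>
  define w where "w d e = (if e = 0 then 2 * d * m else (e * C d - d) * m + 2 * e * \<alpha>)" for d e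
  have val2: "2 * val d e = w d e" if "e \<in> {-1, 0, 1}" for d e
  proof -
    have "even (e * C d - d)" if "e \<noteq> 0" using that \<open>e \<in> _\<close> by (auto simp: C_def)
    then show ?thesis by (auto simp: val_def w_def algebra_simps elim!: evenE)
  qed
  have setE: "set (E d) = {-1, 0, 1}" "length (E d) = 3" for d
    by (auto simp: E_def s_def)
  have Ej: "E d ! j \<in> {-1, 0, 1}" if "j < 3" for d j
    using setE[of d] that nth_mem by metis
  define col where "col j d = val d (E d ! j)" for j d
  let ?cs = "map col [0, 1, 2]"
  have cols: "sum (col j) {-H..H} = 0" if j: "j \<in> {0, 1, 2}" for j
  proof -
    let ?g = "\<lambda>d. w d (E d ! j)"
    have far: "?g d + ?g (- d) = 0" if "d \<in> {4..H}" for d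
    proof -
      have "E d = [0, 1, -1]" "E (- d) = [0, -1, 1]" using that by (auto simp: E_def s_def)
      moreover have "C (- d) = C d" by (simp add: C_def)
      ultimately show ?thesis using j by (auto simp: w_def algebra_simps)
    qed
    have "{1..H} = {1, 2, 3} \<union> {4..H}" using H by auto
    then have "sum ?g {-H..H} = ?g 0 + (\<Sum>d\<in>{1, 2, 3}. ?g d + ?g (- d)) + (\<Sum>d\<in>{4..H}. ?g d + ?g (- d))"
      using H by (simp add: sum_symmetric_interval sum.union_disjoint)
    also have "(\<Sum>d\<in>{4..H}. ?g d + ?g (- d)) = 0" using far by simp
    also have "?g 0 + (\<Sum>d\<in>{1, 2, 3}. ?g d + ?g (- d)) = 0"
      using j by (auto simp: E_def s_def w_def C_def algebra_simps)
    finally have "sum ?g {-H..H} = 0" by simp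
    moreover have "?g d = 2 * col j d" for d
      using val2[OF Ej[of j d]] j by (auto simp: col_def)
    ultimately show ?thesis by (simp flip: sum_distrib_left)
  qed
  have rows: "(\<Sum>c\<leftarrow>?cs. c d) = 0" for d
  proof -
    have "2 * (\<Sum>c\<leftarrow>?cs. c d) = w d (E d ! 0) + w d (E d ! 1) + w d (E d ! 2)"
      using val2[OF Ej[of 0 d]] val2[OF Ej[of 1 d]] val2[OF Ej[of 2 d]] by (simp add: col_def)
    also have "\<dots> = 0" by (auto simp: E_def s_def w_def algebra_simps)
    finally show ?thesis by simp
  qed
  have hit: "x \<in> (\<Union>c\<in>set ?cs. c ` {-H..H})" if xde: "x = val d e" "\<bar>d\<bar> \<le> H" "e \<in> {-1, 0, 1}" for x d e
  proof -
    obtain j where "j < 3" "e = E d ! j" using setE[of d] xde(3) by (metis in_set_conv_nth)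
    then have "x = col j d" "j \<in> {0, 1, 2}" using xde by (auto simp: col_def)
    moreover have "d \<in> {-H..H}" using xde by auto
    ultimately show ?thesis by auto
  qed
  have cover: "{x. \<exists>a e. \<bar>a\<bar> \<le> H \<and> e \<in> {-1, 0, 1} \<and> x = a * m + e * \<alpha>} \<subseteq> (\<Union>c\<in>set ?cs. c ` {-H..H})"
  proof
    fix x assume "x \<in> {x. \<exists>a e. \<bar>a\<bar> \<le> H \<and> e \<in> {-1, 0, 1} \<and> x = a * m + e * \<alpha>}"
    then obtain a e where ae: "\<bar>a\<bar> \<le> H" "e \<in> {-1, 0, 1}" "x = a * m + e * \<alpha>" by blast
    show "x \<in> (\<Union>c\<in>set ?cs. c ` {-H..H})"
    proof (cases "e = 0")
      case True
      then show ?thesis using hit[of x a 0] ae by (simp add: val_def)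
    next
      case False
      have k: "2 * k \<le> H" "H \<le> 2 * k + 1" by (auto simp: k_def)
      have e: "e = 1 \<or> e = -1" using ae False by auto
      \<comment> \<open>Solving \<open>a = (e * C d - d) / 2\<close> gives
        \<open>d = e * C d - 2 * a\<close>. The threshold selects the parity of \<open>d\<close> for
        which the solution satisfies \<open>\<bar>d\<bar> \<le> H\<close>.\<close>
      let ?d = "if e * a * 2 \<le> 2 * k - H then e * (2 * k - 2 * H) - 2 * a else e * (2 * k + 1) - 2 * a"
      have "\<bar>?d\<bar> \<le> H" using e ae(1) k by auto
      moreover have "e * C ?d - ?d = 2 * a" using e by (auto simp: C_def)
      ultimately show ?thesis using hit[of x ?d e] ae False by (simp add: val_def)
    qed
  qed
  show ?thesis
    unfolding zero_sum_array_def
  proof (intro exI[of _ ?cs] conjI)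
    show "\<forall>c\<in>set ?cs. sum c {-H..H} = 0" using cols by simp
    show "\<forall>i\<in>{-H..H}. (\<Sum>c\<leftarrow>?cs. c i) = 0" using rows by blast
  qed (use cover in simp_all)
qed

text \<open>The set consists of \<open>t\<close> and \<open>-t\<close> for \<open>t\<close> from 1
  to \<open>k div 2\<close>, together with 0 when \<open>k\<close> is odd.\<close>

lemma zero_sum_set_exists:
  "\<exists>M :: int set. finite M \<and> card M = k \<and> \<Sum>M = 0 \<and> (\<forall>x\<in>M. 2 * \<bar>x\<bar> \<le> int k)"
proof (induction k rule: nat_induct2)
  case 0
  show ?case by (intro exI[of _ "{}"]) simp
next
  case 1
  show ?case by (intro exI[of _ "{0}"]) simp
next
  case (step k)
  then obtain M :: "int set" where M: "finite M" "card M = k" "\<Sum>M = 0" "\<forall>x\<in>M. 2 * \<bar>x\<bar> \<le> int k" by blast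
  define t where "t = int k div 2 + 1"
  have t: "int k < 2 * t" "2 * t \<le> int k + 2" by (auto simp: t_def)
  then have "t \<notin> M" "- t \<notin> M" "t \<noteq> - t" using M(4) by force+
  then show ?case using M t by (intro exI[of _ "insert t (insert (- t) M)"]) (auto intro: order_trans)
qed

text \<open>For \<open>r > 1\<close> the elements \<open>H\<close> and \<open>s - H\<close>
  contribute \<open>s\<close>, and \<open>r - 2\<close> small elements cancel. The bound
  \<open>s + r \<le> H\<close> keeps the two large elements apart from the small ones.\<close>

lemma subset_with_sum_exists:
  fixes H s :: int
  assumes "r \<ge> 1" "0 \<le> s" "s + int r \<le> H"
  shows "\<exists>M \<subseteq> {-H..H}. card M = r \<and> \<Sum>M = s"
proof (cases "r = 1")
  case True
  then show ?thesis using assms by (intro exI[of _ "{s}"]) auto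
next
  case False
  obtain M :: "int set" where M: "finite M" "card M = r - 2" "\<Sum>M = 0" "\<forall>x\<in>M. 2 * \<bar>x\<bar> \<le> int (r - 2)"
    using zero_sum_set_exists by blast
  have "\<bar>x\<bar> < int r" if "x \<in> M" for x using M(4) that False assms by force
  then have "H \<notin> M" "s - H \<notin> M" "M \<subseteq> {-H..H}" using assms by force+
  moreover have "H \<noteq> s - H" using assms by linarith
  ultimately show ?thesis using M assms False
    by (intro exI[of _ "insert H (insert (s - H) M)"]) auto
qed

text \<open>Flipping the signs on \<open>M\<close> subtracts twice the sum over \<open>M\<close>. A
  column sum thus depends only on the size and the sum of \<open>M\<close>.\<close>

lemma sum_signed_affine:
  fixes H m b :: int
  assumes "H \<ge> 0" "M \<subseteq> {-H..H}"
  shows "(\<Sum>a\<in>{-H..H}. (if a \<in> M then -1 else 1) * (a * m + b)) =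
    (2 * H + 1) * b - 2 * (m * \<Sum>M + int (card M) * b)"
proof -
  have "(\<Sum>a\<in>{-H..H}. (if a \<in> M then -1 else 1) * (a * m + b)) =
      (\<Sum>a\<in>{-H..H}. (a * m + b) - 2 * (if a \<in> M then a * m + b else 0))"
    by (rule sum.cong) auto
  also have "\<dots> = (\<Sum>a\<in>{-H..H}. a * m + b) - 2 * (\<Sum>a\<in>{-H..H}. if a \<in> M then a * m + b else 0)"
    by (simp add: sum_subtractf sum_distrib_left)
  also have "(\<Sum>a\<in>{-H..H}. if a \<in> M then a * m + b else 0) = (\<Sum>a\<in>M. a * m + b)"
    using assms(2) by (simp add: sum.inter_restrict[symmetric] Int_absorb1)
  also have "(\<Sum>a\<in>M. a * m + b) = m * \<Sum>M + int (card M) * b"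
    by (simp add: sum.distrib sum_distrib_left mult.commute)
  also have "(\<Sum>a\<in>{-H..H}. a * m + b) = (2 * H + 1) * b"
    using assms(1) by (simp add: sum_symmetric_interval algebra_simps)
  finally show ?thesis .
qed

text \<open>For \<open>m = 2 * h + 1\<close> and \<open>0 \<le> b \<le> h\<close>, these are the
  numbers with low digit \<open>b\<close> or \<open>-b\<close> in balanced base \<open>m\<close>.
  Closure under negation suits the column pairs \<open>g\<close>, \<open>-g\<close>.\<close>

definition digit_class :: "int \<Rightarrow> int \<Rightarrow> int \<Rightarrow> int set" where
  "digit_class H m b = {x. \<exists>a. \<bar>a\<bar> \<le> H \<and> (x = a * m + b \<or> x = - (a * m + b))}"

text \<open>With \<open>r\<close> flipped signs the column sum is
  \<open>m * b - 2 * m * \<Sum>M\<close>, where \<open>m = 2 * h + 1\<close>, so it vanishes once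
  \<open>M\<close> has sum \<open>b / 2\<close>.\<close>

lemma zero_sum_array_even_digit:
  fixes b h :: int
  assumes r: "r \<ge> 1" and b: "even b" "0 \<le> b" "b \<le> h"
  shows "zero_sum_array {-(h + int r)..h + int r} 2 (digit_class (h + int r) (2 * h + 1) b)"
proof -
  define H where "H = h + int r"
  obtain s where s: "b = 2 * s" using b by (elim evenE)
  obtain M where M: "M \<subseteq> {-H..H}" "card M = r" "\<Sum>M = s"
    using subset_with_sum_exists[OF r, of s H] b s by (auto simp: H_def)
  let ?g = "\<lambda>a. (if a \<in> M then -1 else 1) * (a * (2 * h + 1) + b)"
  have "H \<ge> 0" using b by (simp add: H_def)
  then have "sum ?g {-H..H} = 0"
    using sum_signed_affine[OF _ M(1), of "2 * h + 1" b] M by (simp add: H_def s algebra_simps)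
  then have "zero_sum_array {-H..H} 2 (digit_class H (2 * h + 1) b)"
  proof (rule zero_sum_array_pair)
    fix x assume "x \<in> digit_class H (2 * h + 1) b"
    then obtain a where a: "\<bar>a\<bar> \<le> H" "x = a * (2 * h + 1) + b \<or> x = - (a * (2 * h + 1) + b)"
      unfolding digit_class_def by blast
    then show "\<exists>i\<in>{-H..H}. x = ?g i \<or> x = - ?g i" by (intro bexI[of _ a]) auto
  qed
  then show ?thesis by (simp only: H_def)
qed

text \<open>For odd \<open>b\<close> no choice of signs gives a zero sum; the two columns for \<open>b\<close> and \<open>b + 2\<close>
  exchange two entries each.\<close>

lemma zero_sum_array_odd_digits:
  fixes b h :: int
  assumes r: "r \<ge> 1" and b: "1 \<le> b" "b + 2 \<le> h"
  shows "zero_sum_array {-(h + int r)..h + int r} 4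
    (digit_class (h + int r) (2 * h + 1) b \<union> digit_class (h + int r) (2 * h + 1) (b + 2))"
proof -
  define H where "H = h + int r"
  define m where "m = 2 * h + 1"
  \<comment> \<open>With \<open>r - 1\<close> flipped signs and \<open>\<Sum>M = 0\<close>, the
    column of digit \<open>c\<close> sums to \<open>(m + 2) * c\<close>. The exchange cancels this
    for both \<open>b\<close> and \<open>b + 2\<close> exactly when \<open>a1 + a1' = b + 1\<close>
    and \<open>a2' - a2 = 1\<close>. The four positions are chosen with large modulus so as to avoid
    \<open>M\<close>.\<close>
  define a1 a1' a2 a2' where "a1 = H - 2" and "a1' = b + 3 - H" and "a2 = H - 1" and "a2' = H"
  note defs = a1_def a1'_def a2_def a2'_def
  obtain M :: "int set" where M: "finite M" "card M = r - 1" "\<Sum>M = 0" "\<forall>x\<in>M. 2 * \<bar>x\<bar> \<le> int (r - 1)"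
    using zero_sum_set_exists by blast
  have Mr: "2 * \<bar>x\<bar> \<le> int r - 1 \<and> r \<noteq> 1" if "x \<in> M" for x using M that r by (force simp: of_nat_diff)
  have MH: "M \<subseteq> {-H..H}" using Mr b by (force simp: H_def)
  have notin: "a1 \<notin> M" "a1' \<notin> M" "a2 \<notin> M" "a2' \<notin> M"
    using Mr b r unfolding defs H_def by (force simp: abs_if split: if_splits)+
  have I: "a1 \<in> {-H..H}" "a1' \<in> {-H..H}" "a2 \<in> {-H..H}" "a2' \<in> {-H..H}"
    using b r by (auto simp: defs H_def)
  have ne: "a1 \<noteq> a2" "a1' \<noteq> a2'" using b r by (auto simp: defs H_def)
  let ?f = "\<lambda>b a. (if a \<in> M then -1 else 1) * (a * m + b)"
  have sumf: "sum (?f c) {-H..H} = (m + 2) * c" for c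
    using sum_signed_affine[OF _ MH, of m c] M(2,3) b r
    by (simp add: H_def m_def of_nat_diff algebra_simps)
  have exch: "(\<Sum>a\<in>{-H..H}. if a = p then u else if a = q then v else ?f c a) =
      (m + 2) * c - ?f c p - ?f c q + u + v"
    if "p \<in> {-H..H}" "q \<in> {-H..H}" "p \<noteq> q" for p q u v c
  proof -
    let ?R = "{-H..H} - {p, q}"
    have split: "sum g {-H..H} = g p + g q + sum g ?R" for g :: "int \<Rightarrow> int"
      using that sum.subset_diff[of "{p, q}" "{-H..H}" g] by simp
    have "sum (\<lambda>a. if a = p then u else if a = q then v else ?f c a) ?R = sum (?f c) ?R"
      by (rule sum.cong) auto
    then show ?thesis
      using split[of "?f c"] split[of "\<lambda>a. if a = p then u else if a = q then v else ?f c a"] sumf[of c] that(3)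
      by simp
  qed
  let ?g = "\<lambda>a. if a = a1 then - (a1' * m + (b + 2)) else if a = a2 then a2' * m + (b + 2) else ?f b a"
  let ?g' = "\<lambda>a. if a = a1' then - (a1 * m + b) else if a = a2' then a2 * m + b else ?f (b + 2) a"
  have "sum ?g {-H..H} = 0"
    using exch[OF I(1,3) ne(1), of "- (a1' * m + (b + 2))" "a2' * m + (b + 2)" b] notin
    by (simp add: defs algebra_simps)
  then have 1: "zero_sum_array {-H..H} 2 {x. \<exists>i\<in>{-H..H}. x = ?g i \<or> x = - ?g i}"
    by (rule zero_sum_array_pair) blast
  have "sum ?g' {-H..H} = 0"
    using exch[OF I(2,4) ne(2), of "- (a1 * m + b)" "a2 * m + b" "b + 2"] notin
    by (simp add: defs algebra_simps)
  then have 2: "zero_sum_array {-H..H} 2 {x. \<exists>i\<in>{-H..H}. x = ?g' i \<or> x = - ?g' i}"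
    by (rule zero_sum_array_pair) blast
  let ?U = "{x. \<exists>i\<in>{-H..H}. x = ?g i \<or> x = - ?g i} \<union> {x. \<exists>i\<in>{-H..H}. x = ?g' i \<or> x = - ?g' i}"
  have U: "x \<in> ?U" if "i \<in> {-H..H}" "x = ?g i \<or> x = - ?g i \<or> x = ?g' i \<or> x = - ?g' i" for x i
    using that by blast
  have "x \<in> ?U" if x: "\<bar>a\<bar> \<le> H" "x = a * m + b \<or> x = - (a * m + b)" for x a
  proof -
    have "a \<in> {-H..H}" using x by auto
    consider "a = a1" | "a = a2" | "a \<noteq> a1" "a \<noteq> a2" by blast
    then show ?thesis
    proof cases
      case 1
      show ?thesis by (rule U[OF I(2)]) (use x 1 in auto)
    next
      case 2
      show ?thesis by (rule U[OF I(4)]) (use x 2 ne in auto)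
    next
      case 3
      show ?thesis by (rule U[OF \<open>a \<in> _\<close>]) (use x 3 in auto)
    qed
  qed
  moreover have "x \<in> ?U" if x: "\<bar>a\<bar> \<le> H" "x = a * m + (b + 2) \<or> x = - (a * m + (b + 2))" for x a
  proof -
    have "a \<in> {-H..H}" using x by auto
    consider "a = a1'" | "a = a2'" | "a \<noteq> a1'" "a \<noteq> a2'" by blast
    then show ?thesis
    proof cases
      case 1
      show ?thesis by (rule U[OF I(1)]) (use x 1 in auto)
    next
      case 2
      show ?thesis by (rule U[OF I(3)]) (use x 2 ne in auto)
    next
      case 3
      show ?thesis by (rule U[OF \<open>a \<in> _\<close>]) (use x 3 in auto)
    qed
  qed
  ultimately have "digit_class H m b \<union> digit_class H m (b + 2) \<subseteq> ?U"
    unfolding digit_class_def by blast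
  then have "zero_sum_array {-H..H} (2 + 2) (digit_class H m b \<union> digit_class H m (b + 2))"
    using zero_sum_array_append[OF 1 2] zero_sum_array_mono by blast
  then show ?thesis by (simp add: H_def m_def)
qed

text \<open>The only odd non-square size with both sides at least 3 that is too small for the
  three-column construction.\<close>

lemma zero_sum_array_5_3:
  "zero_sum_array {0..<5::int} 3 {x. \<bar>x\<bar> \<le> 7}"
proof -
  let ?cs = "map (\<lambda>xs i. xs ! nat i) [[-7, -5, 5, 4, 3], [0, -1, -2, 2, 1], [7, 6, -3, -6, -4 :: int]]"
  have I: "{0..<5} = {0, 1, 2, 3, 4 :: int}" by auto
  have "{x :: int. \<bar>x\<bar> \<le> 7} = set [-7..7]" by auto
  also have "\<dots> = (\<Union>c\<in>set ?cs. c ` {0..<5})"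
    unfolding I by (simp add: insert_commute upto.simps del: set_upto)
  finally have "{x. \<bar>x\<bar> \<le> 7} \<subseteq> (\<Union>c\<in>set ?cs. c ` {0..<5})" by blast
  moreover have "\<forall>c\<in>set ?cs. sum c {0..<5} = 0" "\<forall>i\<in>{0..<5}. (\<Sum>c\<leftarrow>?cs. c i) = 0"
    unfolding I by simp_all
  ultimately show ?thesis
    unfolding zero_sum_array_def by (intro exI[of _ ?cs]) simp
qed

text \<open>Induction on the largest low digit \<open>k\<close>: digit 0 and one further digit
  \<alpha> take three columns, and every other digit costs two more. Odd digits must come in pairs
  \<open>b\<close>, \<open>b + 2\<close>. Hence the case \<open>k = 1\<close> uses \<alpha> = 1,
  while \<open>k = 3\<close> uses \<alpha> = 2 and pairs 1 with 3. An even \<open>k\<close> is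
  appended alone, and odd \<open>k\<close> from 5 on proceeds in steps of 4.\<close>

lemma zero_sum_array_odd:
  fixes h r :: nat
  defines "H \<equiv> int h + int r" and "m \<equiv> 2 * int h + 1"
  assumes r: "r \<ge> 1" and h: "h \<ge> 1" and H3: "h + r \<ge> 3"
  shows "zero_sum_array {-H..H} (2 * h + 1) {x. \<bar>x\<bar> \<le> 2 * H * int h + H + int h}"
proof -
  define U where "U k = {x. \<exists>b. 0 \<le> b \<and> b \<le> int k \<and> x \<in> digit_class H m b}" for k
  have core: "zero_sum_array {-H..H} 3 (digit_class H m 0 \<union> digit_class H m \<alpha>)" for \<alpha>
  proof (rule zero_sum_array_mono[OF zero_sum_array_three_columns])
    show "3 \<le> H" using H3 by (simp add: H_def)
    show "digit_class H m 0 \<union> digit_class H m \<alpha> \<subseteq>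
        {x. \<exists>a e. \<bar>a\<bar> \<le> H \<and> e \<in> {- 1, 0, 1} \<and> x = a * m + e * \<alpha>}"
    proof
      fix x assume "x \<in> digit_class H m 0 \<union> digit_class H m \<alpha>"
      then obtain a where a: "\<bar>a\<bar> \<le> H" "x = a * m \<or> x = (- a) * m \<or> x = a * m + \<alpha> \<or> x = (- a) * m - \<alpha>"
        unfolding digit_class_def by auto
      have "a' * m + e * \<alpha> \<in> {x. \<exists>a e. \<bar>a\<bar> \<le> H \<and> e \<in> {- 1, 0, 1} \<and> x = a * m + e * \<alpha>}"
        if "\<bar>a'\<bar> \<le> H" "e \<in> {- 1, 0, 1}" for a' e
        using that by blast
      from this[of a 0] this[of "- a" 0] this[of a 1] this[of "- a" "-1"]
      show "x \<in> {x. \<exists>a e. \<bar>a\<bar> \<le> H \<and> e \<in> {- 1, 0, 1} \<and> x = a * m + e * \<alpha>}"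
        using a by (elim disjE) simp_all
    qed
  qed
  have evens: "zero_sum_array {-H..H} 2 (digit_class H m (int b))" if "even b" "b \<le> h" for b
    using zero_sum_array_even_digit[OF r, of "int b" "int h"] that by (simp add: H_def m_def)
  have odds: "zero_sum_array {-H..H} 4 (digit_class H m (int b) \<union> digit_class H m (int b + 2))"
    if "1 \<le> b" "b + 2 \<le> h" for b
    using zero_sum_array_odd_digits[OF r, of "int b" "int h"] that by (simp add: H_def m_def)
  have "zero_sum_array {-H..H} (2 * k + 1) (U k)" if "1 \<le> k" "k \<le> h" for k
    using that
  proof (induction k rule: less_induct)
    case (less k)
    consider "k = 1" | "k = 3" | "even k" | "odd k" "k \<ge> 5"
      using less.prems by (cases "k = 2 \<or> k = 4") (auto, linarith?)
    then show ?case
    proof cases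
      case 1
      have "b = 0 \<or> b = 1" if "0 \<le> b" "b \<le> 1" for b :: int using that by linarith
      then have "U k \<subseteq> digit_class H m 0 \<union> digit_class H m 1" unfolding U_def 1 by force
      then show ?thesis using zero_sum_array_mono[OF core[of 1]] 1 by simp
    next
      case 2
      have "b = 0 \<or> b = 1 \<or> b = 2 \<or> b = 3" if "0 \<le> b" "b \<le> 3" for b :: int using that by linarith
      then have "U k \<subseteq> (digit_class H m 0 \<union> digit_class H m 2) \<union>
          (digit_class H m (int 1) \<union> digit_class H m (int 1 + 2))"
        unfolding U_def 2 by force
      then show ?thesis
        using zero_sum_array_mono[OF zero_sum_array_append[OF core[of 2] odds[of 1]]] 2 less.prems by simp
    next
      case 3
      then have k: "k - 1 < k" "1 \<le> k - 1" "k - 1 \<le> h" "2 * (k - 1) + 1 + 2 = 2 * k + 1"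
        using less.prems by (cases "k = 1"; auto)+
      have "b \<le> int (k - 1) \<or> b = int k" if "b \<le> int k" for b using that k by linarith
      then have "U k \<subseteq> U (k - 1) \<union> digit_class H m (int k)" unfolding U_def by blast
      then show ?thesis
        using zero_sum_array_mono[OF zero_sum_array_append[OF less.IH[OF k(1-3)] evens[OF 3 less.prems(2)]]]
        unfolding k(4) by blast
    next
      case 4
      define l where "l = k - 4"
      have k: "k = l + 4" "l < k" "1 \<le> l" "l \<le> h" "odd l" using 4 less.prems by (auto simp: l_def)
      have "b \<le> int l \<or> b = int (l + 1) \<or> b = int (l + 3) \<or> b = int (l + 2) \<or> b = int (l + 2) + 2"
        if "b \<le> int k" for b using that k(1) by simp linarith
      then have sub: "U k \<subseteq> U l \<union> digit_class H m (int (l + 1)) \<union> digit_class H m (int (l + 3))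
          \<union> (digit_class H m (int (l + 2)) \<union> digit_class H m (int (l + 2) + 2))"
        unfolding U_def by blast
      have "zero_sum_array {-H..H} (2 * l + 1 + 2 + 2 + 4) (U l \<union> digit_class H m (int (l + 1))
          \<union> digit_class H m (int (l + 3)) \<union> (digit_class H m (int (l + 2)) \<union> digit_class H m (int (l + 2) + 2)))"
        by (intro zero_sum_array_append less.IH evens odds) (use k less.prems in auto)
      then have "zero_sum_array {-H..H} (2 * l + 1 + 2 + 2 + 4) (U k)"
        using sub by (rule zero_sum_array_mono)
      moreover have "2 * l + 1 + 2 + 2 + 4 = 2 * k + 1" using k(1) by simp
      ultimately show ?thesis by (simp only:)
    qed
  qed
  moreover have "{x. \<bar>x\<bar> \<le> 2 * H * int h + H + int h} \<subseteq> U h"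
  proof
    fix x assume "x \<in> {x. \<bar>x\<bar> \<le> 2 * H * int h + H + int h}"
    then obtain a b where ab: "x = a * m + b" "\<bar>a\<bar> \<le> H" "\<bar>b\<bar> \<le> int h"
      using balanced_digits[of x "h + r" h] by (auto simp: H_def m_def)
    have "x \<in> digit_class H m \<bar>b\<bar>"
    proof (cases "b \<ge> 0")
      case True
      then show ?thesis using ab by (auto simp: digit_class_def)
    next
      case False
      then show ?thesis using ab unfolding digit_class_def by (auto intro!: exI[of _ "- a"])
    qed
    then show "x \<in> U h"
      unfolding U_def using ab(3) by (intro CollectI exI[of _ "\<bar>b\<bar>"]) simp
  qed
  ultimately show ?thesis using h zero_sum_array_mono by blast
qed

text \<open>The bound \<open>card V \<ge> 3\<close> excludes the impossible 2 by 2 square, so an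
  even longer side is at least 4. Odd sides split into squares, the 5 by 3 rectangle, and longer
  sides of length at least 7.\<close>

theorem magic_rectangle_exists:
  fixes V :: "'a set" and W :: "'b set"
  assumes fin: "finite V" "finite W" and par: "even (card V) \<longleftrightarrow> even (card W)"
    and card: "card W \<le> card V" "card V \<ge> 3" "card W \<ge> 2"
  shows "\<exists>L. magic_rectangle V W L"
proof (cases "even (card V)")
  case True
  then have "card V \<noteq> 3" by auto
  then show ?thesis
    using magic_rectangle_if_zero_sum_array[OF fin, of "{..<card V}"]
      zero_sum_array_even[OF True, of "card W"] True par card by simp
next
  case False
  then obtain h0 H0 where hH: "card W = 2 * h0 + 1" "card V = 2 * H0 + 1" using par by (metis oddE)
  let ?N = "card V * card W"
  \<comment> \<open>For odd sides the centred values are even, hence twice the integers of modulus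
    at most \<open>(N - 1) / 2\<close>, where \<open>N\<close> is the number of cells.\<close>
  have scale: "\<exists>L. magic_rectangle V W L" if "finite I" "card V = card I"
    "zero_sum_array I (card W) {x. \<bar>x\<bar> \<le> 2 * int H0 * int h0 + int H0 + int h0}" for I :: "int set"
  proof (rule magic_rectangle_if_zero_sum_array[OF fin that(1,2) _ refl],
      rule zero_sum_array_mono[OF zero_sum_array_scale[OF that(3), of 2]], rule subsetI)
    fix x assume "x \<in> {x. \<bar>x\<bar> < int ?N \<and> odd (x + int ?N)}"
    then have x: "\<bar>x\<bar> < int ?N" "even x" using hH by auto
    then obtain y where "x = 2 * y" by (elim evenE)
    then show "x \<in> (*) 2 ` {x. \<bar>x\<bar> \<le> 2 * int H0 * int h0 + int H0 + int h0}"
      using x(1) hH by (auto simp: algebra_simps)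
  qed
  consider "H0 = h0" | "h0 = 1" "H0 = 2" | "H0 > h0" "H0 \<ge> 3" using card hH by linarith
  then show ?thesis
  proof cases
    case 1
    then show ?thesis using zero_sum_array_odd_square[of h0] hH by (intro scale[of "{0..<2 * int h0 + 1}"]) simp_all
  next
    case 2
    then show ?thesis using zero_sum_array_5_3 hH by (intro scale[of "{0..<5}"]) simp_all
  next
    case 3
    then show ?thesis using zero_sum_array_odd[of "H0 - h0" h0] card hH
      by (intro scale[of "{- int H0..int H0}"]) (simp_all add: of_nat_diff)
  qed
qed

section \<open>Joins with edgeless graphs\<close>

lemma verts_join_edgeless [simp]: "verts (graph_join G (edgeless_graph W)) = verts G \<union> W"
  by (simp add: graph_join_def edgeless_graph_def)

lemma edges_join_edgeless:
  "edges (graph_join G (edgeless_graph W)) = edges G \<union> (\<lambda>(v, w). {v, w}) ` (verts G \<times> W)"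
  by (auto simp: graph_join_def edgeless_graph_def)

lemma simple_graph_finite_edges: "simple_graph G \<Longrightarrow> finite (edges G)"
  unfolding simple_graph_def by (meson PowI finite_Pow_iff finite_subset subsetI)

lemma simple_graph_edgeD:
  assumes "simple_graph G" "{u, v} \<in> edges G"
  shows "u \<in> verts G" "v \<in> verts G" "u \<noteq> v"
  using assms unfolding simple_graph_def by fastforce+

locale edgeless_join =
  fixes G :: "'a ugraph" and W :: "'a set"
  assumes simple: "simple_graph G" and finW: "finite W" and disj: "W \<inter> verts G = {}"
begin

abbreviation J where "J \<equiv> graph_join G (edgeless_graph W)"

lemma finV: "finite (verts G)" using simple by (simp add: simple_graph_def)

lemma edge_verts: "e \<in> edges G \<Longrightarrow> e \<subseteq> verts G"
  using simple by (simp add: simple_graph_def)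

lemma inj_cross: "inj_on (\<lambda>(v, w). {v, w}) (verts G \<times> W)"
  using disj by (auto simp: inj_on_def doubleton_eq_iff)

lemma cross_notin: "v \<in> verts G \<Longrightarrow> w \<in> W \<Longrightarrow> {v, w} \<notin> edges G"
  using edge_verts disj by blast

lemma simple_join: "simple_graph J"
proof -
  have "v \<noteq> w" if "v \<in> verts G" "w \<in> W" for v w using that disj by blast
  then show ?thesis
    using simple finW by (auto simp: simple_graph_def edges_join_edgeless card_insert_if)
qed

lemma incident_old:
  assumes "v \<in> verts G"
  shows "{e. e \<in> edges J \<and> v \<in> e} = {e. e \<in> edges G \<and> v \<in> e} \<union> (\<lambda>w. {v, w}) ` W"
  using assms disj by (auto simp: edges_join_edgeless)

lemma incident_new:
  assumes "w \<in> W"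
  shows "{e. e \<in> edges J \<and> w \<in> e} = (\<lambda>v. {v, w}) ` verts G"
  using assms disj edge_verts by (auto simp: edges_join_edgeless)

text \<open>An arbitrary weight \<open>g\<close> is allowed: the constant 1 yields degrees, and a
  labelling yields vertex sums.\<close>

lemma sum_incident_old:
  assumes "v \<in> verts G"
  shows "(\<Sum>e | e \<in> edges J \<and> v \<in> e. g e) = (\<Sum>e | e \<in> edges G \<and> v \<in> e. g e) + (\<Sum>w\<in>W. g {v, w})"
proof -
  have "inj_on (\<lambda>w. {v, w}) W" by (auto simp: inj_on_def doubleton_eq_iff)
  then have "(\<Sum>w\<in>W. g {v, w}) = sum g ((\<lambda>w. {v, w}) ` W)" by (simp add: sum.reindex)
  moreover have "{e. e \<in> edges G \<and> v \<in> e} \<inter> (\<lambda>w. {v, w}) ` W = {}"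
    using assms cross_notin by auto
  ultimately show ?thesis
    unfolding incident_old[OF assms]
    by (subst sum.union_disjoint) (use simple_graph_finite_edges[OF simple] finW in auto)
qed

lemma sum_incident_new:
  assumes "w \<in> W"
  shows "(\<Sum>e | e \<in> edges J \<and> w \<in> e. g e) = (\<Sum>v\<in>verts G. g {v, w})"
proof -
  have "inj_on (\<lambda>v. {v, w}) (verts G)" by (auto simp: inj_on_def doubleton_eq_iff)
  then show ?thesis unfolding incident_new[OF assms] by (simp add: sum.reindex)
qed

lemma degree_old: "v \<in> verts G \<Longrightarrow> graph_degree J v = graph_degree G v + card W"
  using sum_incident_old[of v "\<lambda>_. 1 :: nat"] by (simp add: graph_degree_def)

lemma degree_new: "w \<in> W \<Longrightarrow> graph_degree J w = card (verts G)"
  using sum_incident_new[of w "\<lambda>_. 1 :: nat"] by (simp add: graph_degree_def)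

lemma regular_join:
  assumes "regular_graph G d" "card (verts G) = d + card W"
  shows "regular_graph J (d + card W)"
  using assms degree_old degree_new by (auto simp: regular_graph_def)

lemma order_join: "card (verts J) = card (verts G) + card W"
  using finV finW disj by (simp add: card_Un_disjoint Int_commute)

text \<open>Each old vertex has \<open>d\<close> old edges, so shifting their labels by
  \<open>N\<close> adds \<open>d * N\<close>. Both \<open>f\<close> and \<open>L\<close> are
  arbitrary bijections here, because the double join needs a cross labelling that is not
  magic.\<close>

lemma join_labelling:
  fixes f :: "'a set \<Rightarrow> nat" and L :: "'a \<Rightarrow> 'a \<Rightarrow> nat"
  defines "N \<equiv> card (verts G) * card W"
  assumes f: "bij_betw f (edges G) {1..card (edges G)}"
    and L: "bij_betw (\<lambda>(v, w). L v w) (verts G \<times> W) {1..N}"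
    and reg: "regular_graph G d"
  obtains F where "bij_betw F (edges J) {1..card (edges J)}"
    and "\<And>v. v \<in> verts G \<Longrightarrow> vertex_sum J F v = vertex_sum G f v + d * N + (\<Sum>w\<in>W. L v w)"
    and "\<And>w. w \<in> W \<Longrightarrow> vertex_sum J F w = (\<Sum>v\<in>verts G. L v w)"
proof -
  let ?c = "\<lambda>(v, w). {v, w}" and ?P = "verts G \<times> W"
  define F where "F e = (if e \<in> edges G then f e + N
    else (\<lambda>(v, w). L v w) (inv_into ?P ?c e))" for e
  have F1: "F e = f e + N" if "e \<in> edges G" for e using that by (simp add: F_def)
  have F2: "F {v, w} = L v w" if "v \<in> verts G" "w \<in> W" for v w
  proof -
    have "inv_into ?P ?c (?c (v, w)) = (v, w)" by (rule inv_into_f_f[OF inj_cross]) (use that in simp)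
    then show ?thesis using that cross_notin[OF that] by (simp add: F_def)
  qed
  have dis: "edges G \<inter> ?c ` ?P = {}" using cross_notin by auto
  have cardE: "card (edges J) = card (edges G) + N"
    unfolding edges_join_edgeless N_def
    using dis simple_graph_finite_edges[OF simple] finV finW
    by (subst card_Un_disjoint) (simp_all add: card_image[OF inj_cross] card_cartesian_product)
  have "bij_betw F (edges G \<union> ?c ` ?P) ({N + 1..N + card (edges G)} \<union> {1..N})"
  proof (rule bij_betw_combine)
    have "bij_betw (\<lambda>e. f e + N) (edges G) {N + 1..N + card (edges G)}"
    proof -
      have "bij_betw (\<lambda>x. x + N) {1..card (edges G)} {N + 1..N + card (edges G)}"
        by (rule bij_betw_byWitness[where f' = "\<lambda>x. x - N"]) auto
      then show ?thesis using bij_betw_trans[OF f] by (simp add: o_def)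
    qed
    then show "bij_betw F (edges G) {N + 1..N + card (edges G)}"
      using bij_betw_cong[of "edges G" F "\<lambda>e. f e + N"] F1 by blast
    have "bij_betw (F \<circ> ?c) ?P {1..N}"
      using bij_betw_cong[of ?P "F \<circ> ?c" "\<lambda>(v, w). L v w"] L F2 by auto
    moreover have "bij_betw ?c ?P (?c ` ?P)" using inj_cross by (simp add: bij_betw_def)
    ultimately show "bij_betw F (?c ` ?P) {1..N}" using bij_betw_comp_iff by blast
  qed auto
  moreover have "{N + 1..N + card (edges G)} \<union> {1..N} = {1..card (edges J)}"
    unfolding cardE by auto
  ultimately have "bij_betw F (edges J) {1..card (edges J)}" by (simp add: edges_join_edgeless)
  moreover have "vertex_sum J F v = vertex_sum G f v + d * N + (\<Sum>w\<in>W. L v w)" if v: "v \<in> verts G" for v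
  proof -
    have "(\<Sum>e | e \<in> edges G \<and> v \<in> e. F e) = (\<Sum>e | e \<in> edges G \<and> v \<in> e. f e + N)"
      by (rule sum.cong) (auto simp: F1)
    also have "\<dots> = vertex_sum G f v + d * N"
      using reg v by (simp add: sum.distrib vertex_sum_def regular_graph_def graph_degree_def)
    finally show ?thesis
      unfolding vertex_sum_def[of J] sum_incident_old[OF v] using F2[OF v] by simp
  qed
  moreover have "vertex_sum J F w = (\<Sum>v\<in>verts G. L v w)" if "w \<in> W" for w
    unfolding vertex_sum_def sum_incident_new[OF that] using F2[OF _ that] by simp
  ultimately show ?thesis using that by blast
qed

lemma join_edge_cases:
  assumes "{u, v} \<in> edges J"
  obtains "{u, v} \<in> edges G" | "u \<in> verts G" "v \<in> W" | "u \<in> W" "v \<in> verts G"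
  using assms by (auto simp: edges_join_edgeless doubleton_eq_iff)

end

section \<open>Upper bounds from labellings and lower bounds from colourings\<close>

definition la_bound :: "'a ugraph \<Rightarrow> nat \<Rightarrow> bool" where
  "la_bound G c \<longleftrightarrow> (\<exists>f. local_antimagic G f \<and> card (vertex_sum G f ` verts G) \<le> c)"

lemma chi_la_le: "la_bound G c \<Longrightarrow> chi_la G \<le> enat c"
  unfolding la_bound_def chi_la_def by (auto intro: INF_lower2)

text \<open>A finite value of the infimum forces the set of candidates to be nonempty, and then the
  infimum is attained.\<close>

lemma la_bound_if_chi_la_eq:
  assumes "chi_la G = enat c"
  shows "la_bound G c"
proof -
  let ?A = "(\<lambda>f. enat (card (vertex_sum G f ` verts G))) ` {f. local_antimagic G f}"
  have "?A \<noteq> {}" using assms unfolding chi_la_def by (auto simp: Inf_enat_def split: if_splits)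
  then have "Inf ?A \<in> ?A" by (simp only: Inf_enat_def if_False) (metis LeastI ex_in_conv)
  then have "enat c \<in> ?A" using assms by (simp add: chi_la_def)
  then show ?thesis unfolding la_bound_def by auto
qed

text \<open>The values of \<open>g\<close> are renumbered as an initial segment. Both vertex sums
  and colourings inherited from a join are instances of \<open>g\<close>.\<close>

lemma chromatic_number_le_card:
  assumes "simple_graph G" "\<And>u v. {u, v} \<in> edges G \<Longrightarrow> g u \<noteq> g v"
  shows "chromatic_number G \<le> card (g ` verts G)"
proof -
  have "finite (g ` verts G)" using assms(1) by (simp add: simple_graph_def)
  then obtain \<phi> where \<phi>: "bij_betw \<phi> (g ` verts G) {..<card (g ` verts G)}"
    using bij_betw_iff_card[of "g ` verts G" "{..<card (g ` verts G)}"] by auto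
  have "\<phi> (g u) \<noteq> \<phi> (g v)" if "{u, v} \<in> edges G" for u v
    using assms(2)[OF that] simple_graph_edgeD[OF assms(1) that] \<phi>
    by (auto simp: bij_betw_def inj_on_def)
  moreover have "(\<phi> \<circ> g) ` verts G \<subseteq> {..<card (g ` verts G)}" using \<phi> by (auto simp: bij_betw_def)
  ultimately show ?thesis
    unfolding chromatic_number_def proper_colouring_def by (intro Least_le exI[of _ "\<phi> \<circ> g"]) simp
qed

lemma chromatic_number_attained:
  assumes "simple_graph G"
  obtains c where "proper_colouring G c" "c ` verts G \<subseteq> {..<chromatic_number G}"
proof -
  have "finite (verts G)" using assms by (simp add: simple_graph_def)
  then obtain \<phi> where \<phi>: "bij_betw \<phi> (verts G) {..<card (verts G)}"
    using bij_betw_iff_card[of "verts G" "{..<card (verts G)}"] by auto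
  have "proper_colouring G \<phi>"
    unfolding proper_colouring_def
    using simple_graph_edgeD[OF assms] \<phi> by (metis bij_betw_imp_inj_on inj_onD)
  moreover have "\<phi> ` verts G \<subseteq> {..<card (verts G)}" using \<phi> by (auto simp: bij_betw_def)
  ultimately have "\<exists>n c. proper_colouring G c \<and> c ` verts G \<subseteq> {..<n}" by blast
  then have "\<exists>c. proper_colouring G c \<and> c ` verts G \<subseteq> {..<chromatic_number G}"
    unfolding chromatic_number_def by (rule LeastI_ex)
  then show ?thesis using that by blast
qed

text \<open>The vertex sums of a local antimagic labelling form a proper colouring; without any
  labelling the right side is infinite.\<close>

lemma chromatic_number_le_chi_la:
  assumes "simple_graph G"
  shows "enat (chromatic_number G) \<le> chi_la G"
  unfolding chi_la_def local_antimagic_def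
  by (rule INF_greatest) (auto intro!: chromatic_number_le_card[OF assms])

text \<open>A new vertex is adjacent to all of \<open>G\<close>, so its colour does not occur on
  \<open>G\<close>.\<close>

lemma (in edgeless_join) chromatic_number_join:
  assumes "W \<noteq> {}"
  shows "chromatic_number G + 1 \<le> chromatic_number J"
proof -
  obtain c where c: "proper_colouring J c" "c ` verts J \<subseteq> {..<chromatic_number J}"
    using chromatic_number_attained[OF simple_join] by blast
  obtain w where w: "w \<in> W" using assms by blast
  have "c v \<noteq> c w" if "v \<in> verts G" for v
    using c(1) that w unfolding proper_colouring_def edges_join_edgeless by blast
  then have sub: "c ` verts G \<subseteq> {..<chromatic_number J} - {c w}" using c(2) by auto
  have "chromatic_number G \<le> card (c ` verts G)"
    using c(1) by (intro chromatic_number_le_card[OF simple]) (auto simp: proper_colouring_def edges_join_edgeless)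
  also have "\<dots> \<le> card ({..<chromatic_number J} - {c w})" by (rule card_mono[OF _ sub]) simp
  also have "\<dots> = chromatic_number J - 1" using c(2) w by (subst card_Diff_singleton) auto
  \<comment> \<open>Since \<open>c w\<close> is a colour below \<open>chromatic_number J\<close>,
    the subtraction does not truncate.\<close>
  finally show ?thesis using c(2) w by fastforce
qed

section \<open>Labelling joins by magic rectangles\<close>

context edgeless_join
begin

text \<open>With \<open>n = d + m\<close> old and \<open>m\<close> new vertices and
  \<open>N = n * m\<close>, the gap \<open>A - B\<close> is
  \<open>d * N + m * (N + 1) / 2 - n * (N + 1) / 2 = d * (N - 1) / 2\<close>, which is positive. The
  labelling is exposed because the double join starts from it.\<close>

lemma magic_join_labelling:
  assumes f: "local_antimagic G f" and reg: "regular_graph G d" and d: "even d" "d > 0"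
    and card: "card (verts G) = d + card W" "card W \<ge> 2"
  obtains F A B where "bij_betw F (edges J) {1..card (edges J)}"
    and "\<And>v. v \<in> verts G \<Longrightarrow> vertex_sum J F v = vertex_sum G f v + A"
    and "\<And>w. w \<in> W \<Longrightarrow> vertex_sum J F w = B" and "B < A"
proof -
  let ?m = "card W"
  let ?N = "card (verts G) * ?m"
  have "even (card (verts G)) \<longleftrightarrow> even ?m" "?m \<le> card (verts G)" "card (verts G) \<ge> 3"
    using d card by auto
  then obtain L where "magic_rectangle (verts G) W L"
    using magic_rectangle_exists[OF finV finW] card(2) by blast
  then have L: "bij_betw (\<lambda>(v, w). L v w) (verts G \<times> W) {1..?N}"
    "\<And>v. v \<in> verts G \<Longrightarrow> 2 * (\<Sum>w\<in>W. L v w) = ?m * (?N + 1)"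
    "\<And>w. w \<in> W \<Longrightarrow> 2 * (\<Sum>v\<in>verts G. L v w) = card (verts G) * (?N + 1)"
    unfolding magic_rectangle_def by blast+
  have f': "bij_betw f (edges G) {1..card (edges G)}" using f by (simp add: local_antimagic_def)
  obtain F where F: "bij_betw F (edges J) {1..card (edges J)}"
    "\<And>v. v \<in> verts G \<Longrightarrow> vertex_sum J F v = vertex_sum G f v + d * ?N + (\<Sum>w\<in>W. L v w)"
    "\<And>w. w \<in> W \<Longrightarrow> vertex_sum J F w = (\<Sum>v\<in>verts G. L v w)"
    using join_labelling[OF f' L(1) reg] by blast
  define A B where "A = d * ?N + ?m * (?N + 1) div 2" and "B = card (verts G) * (?N + 1) div 2"
  have rows: "(\<Sum>w\<in>W. L v w) = ?m * (?N + 1) div 2" if "v \<in> verts G" for v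
    using L(2)[OF that] by simp
  have columns: "(\<Sum>v\<in>verts G. L v w) = B" if "w \<in> W" for w
    using L(3)[OF that] unfolding B_def by simp
  \<comment> \<open>A margin of 2 between the doubled quantities keeps the inequality strict under
    \<open>div 2\<close>.\<close>
  have "1 * 2 \<le> card (verts G) * ?m" using card d by (intro mult_mono) auto
  then have "d * 2 \<le> d * ?N" by (intro mult_left_mono) auto
  moreover have "d \<ge> 2" using d by (auto elim!: evenE)
  moreover have "card (verts G) * (?N + 1) = d * ?N + d + ?m * (?N + 1)"
    unfolding card(1) by (simp add: algebra_simps)
  ultimately have "card (verts G) * (?N + 1) + 2 \<le> 2 * (d * ?N) + ?m * (?N + 1)"
    by linarith
  then have "B < A" unfolding A_def B_def by linarith
  then show ?thesis using that[OF F(1)] F(2,3) rows columns by (simp add: A_def)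
qed

lemma la_bound_join:
  assumes "la_bound G c" and reg: "regular_graph G d" and d: "even d" "d > 0"
    and card: "card (verts G) = d + card W" "card W \<ge> 2"
  shows "la_bound J (c + 1)"
proof -
  obtain f where f: "local_antimagic G f" "card (vertex_sum G f ` verts G) \<le> c"
    using assms(1) unfolding la_bound_def by blast
  obtain F A B where F: "bij_betw F (edges J) {1..card (edges J)}"
    "\<And>v. v \<in> verts G \<Longrightarrow> vertex_sum J F v = vertex_sum G f v + A"
    "\<And>w. w \<in> W \<Longrightarrow> vertex_sum J F w = B" "B < A"
    using magic_join_labelling[OF f(1) reg d card] by blast
  have "vertex_sum J F u \<noteq> vertex_sum J F v" if "{u, v} \<in> edges J" for u v
    using that
  proof (cases rule: join_edge_cases)
    case 1
    then show ?thesis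
      using f(1) simple_graph_edgeD[OF simple 1] F(2) by (simp add: local_antimagic_def)
  qed (use F(2-4) in auto)
  moreover have "vertex_sum J F ` verts J \<subseteq> insert B ((\<lambda>x. x + A) ` vertex_sum G f ` verts G)"
    using F(2,3) by auto
  then have "card (vertex_sum J F ` verts J) \<le> card (insert B ((\<lambda>x. x + A) ` vertex_sum G f ` verts G))"
    by (rule card_mono[rotated]) (use finV in simp)
  then have "card (vertex_sum J F ` verts J) \<le> c + 1"
    using f(2) card_image_le[of "vertex_sum G f ` verts G" "\<lambda>x. x + A"] finV
    by (simp add: card_insert_if split: if_splits)
  ultimately show ?thesis using F(1) unfolding la_bound_def local_antimagic_def by blast
qed

end

text \<open>When the number \<open>m\<close> of new vertices is odd, a single step leads to a graph of even
  order, which admits no magic rectangle with \<open>m\<close> columns.  Hence two steps are taken at once,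
  using a magic square between the two new parts.\<close>

lemma la_bound_join_twice:
  fixes G :: "'a ugraph" and W0 W1 :: "'a set"
  defines "G1 \<equiv> graph_join G (edgeless_graph W0)"
  assumes G: "edgeless_join G W0" and G1: "edgeless_join G1 W1" and bound: "la_bound G c"
    and reg: "regular_graph G d" and d: "even d" "d > 0"
    and m: "card W0 = m" "card W1 = m" "odd m" "m \<ge> 2" and card: "card (verts G) = d + m"
  shows "la_bound (graph_join G1 (edgeless_graph W1)) (c + 2)"
proof -
  interpret G: edgeless_join G W0 by (fact G)
  interpret G1: edgeless_join G1 W1 by (fact G1)
  define V n where "V = verts G" and "n = card V"
  have n: "n = d + m" by (simp add: n_def V_def card)
  have finV: "finite V" using G.finV by (simp add: V_def)
  have V1: "verts G1 = V \<union> W0" by (simp add: G1_def V_def)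
  have VW0: "V \<inter> W0 = {}" using G.disj by (auto simp: V_def)
  obtain f where f: "local_antimagic G f" "card (vertex_sum G f ` verts G) \<le> c"
    using bound unfolding la_bound_def by blast
  obtain F A B where F: "bij_betw F (edges G1) {1..card (edges G1)}"
    "\<And>v. v \<in> V \<Longrightarrow> vertex_sum G1 F v = vertex_sum G f v + A"
    "\<And>w. w \<in> W0 \<Longrightarrow> vertex_sum G1 F w = B" "B < A"
    using G.magic_join_labelling[OF f(1) reg d] card m unfolding G1_def V_def by metis
  \<comment> \<open>The magic square between \<open>W0\<close> and \<open>W1\<close> requires side
    at least 3.\<close>
  have m3: "m \<ge> 3" using m(3,4) by (cases "m = 2") auto
  obtain L where L: "bij_betw (\<lambda>(v, w). L v w) (V \<times> W1) {1..n * m}"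
    "\<And>v. v \<in> V \<Longrightarrow> 2 * (\<Sum>w\<in>W1. L v w) = m * (n * m + 1)"
    "\<And>w. w \<in> W1 \<Longrightarrow> 2 * (\<Sum>v\<in>V. L v w) = n * (n * m + 1)"
    using magic_rectangle_exists[OF finV G1.finW] n m m3 d(1) unfolding magic_rectangle_def n_def by auto
  obtain Q where Q: "bij_betw (\<lambda>(v, w). Q v w) (W0 \<times> W1) {1..m * m}"
    "\<And>v. v \<in> W0 \<Longrightarrow> 2 * (\<Sum>w\<in>W1. Q v w) = m * (m * m + 1)"
    "\<And>w. w \<in> W1 \<Longrightarrow> 2 * (\<Sum>v\<in>W0. Q v w) = m * (m * m + 1)"
    using magic_rectangle_exists[OF G.finW G1.finW] m m3 unfolding magic_rectangle_def by auto
  \<comment> \<open>The square on \<open>W0\<close> takes the small labels and the rectangle on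
    \<open>V\<close> is shifted above it. Columns then have equal sums, while row sums are constant
    on \<open>W0\<close> and on \<open>V\<close> separately.\<close>
  define R where "R v w = (if v \<in> W0 then Q v w else L v w + m * m)" for v w
  have RV: "R v w = L v w + m * m" if "v \<in> V" for v w using that VW0 by (auto simp: R_def)
  have R: "bij_betw (\<lambda>(v, w). R v w) (verts G1 \<times> W1) {1..card (verts G1) * card W1}"
  proof -
    have "bij_betw (\<lambda>(v, w). R v w) (W0 \<times> W1 \<union> V \<times> W1) ({1..m * m} \<union> {m * m + 1..m * m + n * m})"
    proof (rule bij_betw_combine)
      show "bij_betw (\<lambda>(v, w). R v w) (W0 \<times> W1) {1..m * m}"
        using bij_betw_cong[of "W0 \<times> W1" "\<lambda>(v, w). R v w" "\<lambda>(v, w). Q v w"] Q(1) by (auto simp: R_def)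
      have "bij_betw (\<lambda>x. x + m * m) {1..n * m} {m * m + 1..m * m + n * m}"
        by (rule bij_betw_byWitness[where f' = "\<lambda>x. x - m * m"]) auto
      from bij_betw_trans[OF L(1) this]
      show "bij_betw (\<lambda>(v, w). R v w) (V \<times> W1) {m * m + 1..m * m + n * m}"
        using bij_betw_cong[of "V \<times> W1" "\<lambda>(v, w). R v w" "(\<lambda>x. x + m * m) \<circ> (\<lambda>(v, w). L v w)"] RV by auto
    qed auto
    moreover have "W0 \<times> W1 \<union> V \<times> W1 = verts G1 \<times> W1" unfolding V1 by auto
    moreover have "card (verts G1) = n + m"
      using G.order_join m unfolding G1_def n_def V_def by simp
    then have "{1..m * m} \<union> {m * m + 1..m * m + n * m} = {1..card (verts G1) * card W1}"
      unfolding m by (auto simp: algebra_simps)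
    ultimately show ?thesis by simp
  qed
  have reg1: "regular_graph G1 n"
    using G.regular_join[OF reg] card m n unfolding G1_def by simp
  let ?J = "graph_join G1 (edgeless_graph W1)"
  define N where "N = card (verts G1) * card W1"
  obtain F' where F': "bij_betw F' (edges ?J) {1..card (edges ?J)}"
    "\<And>v. v \<in> verts G1 \<Longrightarrow> vertex_sum ?J F' v = vertex_sum G1 F v + n * N + (\<Sum>w\<in>W1. R v w)"
    "\<And>w. w \<in> W1 \<Longrightarrow> vertex_sum ?J F' w = (\<Sum>v\<in>verts G1. R v w)"
    using G1.join_labelling[OF F(1) R reg1] unfolding N_def by blast
  define q l k where "q = m * (m * m + 1) div 2" and "l = m * (n * m + 1) div 2"
    and "k = n * (n * m + 1) div 2"
  have sV: "vertex_sum ?J F' v = vertex_sum G f v + (A + n * N + l + m * (m * m))" if v: "v \<in> V" for v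
  proof -
    have "(\<Sum>w\<in>W1. R v w) = l + m * (m * m)"
      using L(2)[OF v] m(2) by (simp add: RV[OF v] sum.distrib l_def)
    then show ?thesis using F'(2)[of v] F(2)[OF v] v V1 by simp
  qed
  have sW0: "vertex_sum ?J F' v = B + n * N + q" if v: "v \<in> W0" for v
  proof -
    have "(\<Sum>w\<in>W1. R v w) = q" using Q(2)[OF v] v by (simp add: R_def q_def)
    then show ?thesis using F'(2)[of v] F(3)[OF v] v V1 by simp
  qed
  have sW1: "vertex_sum ?J F' w = q + k + n * (m * m)" if w: "w \<in> W1" for w
  proof -
    have "(\<Sum>v\<in>verts G1. R v w) = (\<Sum>v\<in>V. R v w) + (\<Sum>v\<in>W0. R v w)"
      unfolding V1 using finV G.finW VW0 by (rule sum.union_disjoint)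
    also have "(\<Sum>v\<in>V. R v w) = k + n * (m * m)"
      using L(3)[OF w] by (simp add: RV sum.distrib k_def n_def)
    also have "(\<Sum>v\<in>W0. R v w) = q" using Q(3)[OF w] by (simp add: R_def q_def)
    finally show ?thesis using F'(3)[OF w] by simp
  qed
  \<comment> \<open>\<open>ql\<close> preserves the order of \<open>B\<close> and \<open>A\<close>,
    so \<open>W0\<close> stays below \<open>V\<close>; \<open>kN\<close> places \<open>W1\<close>
    below \<open>W0\<close>.\<close>
  have ql: "q \<le> l" unfolding q_def l_def using n by (intro div_le_mono mult_mono add_mono) auto
  have kN: "k + n * (m * m) < n * N"
  proof -
    have "1 * 2 \<le> n * m" using n d m by (intro mult_mono) auto
    then have "n * m + 1 < 2 * (n * m)" by linarith
    then have "n * (n * m + 1) < n * (2 * (n * m))" using n d by (intro mult_strict_left_mono) auto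
    then have "k < n * (n * m)" unfolding k_def by linarith
    moreover have "N = n * m + m * m"
      using G.order_join m unfolding N_def G1_def n_def V_def by (simp add: algebra_simps)
    ultimately show ?thesis by (simp add: algebra_simps)
  qed
  \<comment> \<open>Every sum on \<open>V\<close> is at least \<open>A'\<close>, which separates the
    three parts; the only new colours are \<open>B'\<close> and \<open>C'\<close>.\<close>
  define A' B' C' where "A' = A + n * N + l + m * (m * m)" and "B' = B + n * N + q"
    and "C' = q + k + n * (m * m)"
  have ord: "C' < B'" "B' < A'" using ql kN F(4) by (simp_all add: A'_def B'_def C'_def)
  note s = sV[folded A'_def] sW0[folded B'_def] sW1[folded C'_def]
  have "vertex_sum ?J F' u \<noteq> vertex_sum ?J F' v" if "{u, v} \<in> edges ?J" for u v
    using that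
  proof (cases rule: G1.join_edge_cases)
    case 1
    then have "{u, v} \<in> edges (graph_join G (edgeless_graph W0))" by (simp add: G1_def)
    then show ?thesis
    proof (cases rule: G.join_edge_cases)
      case 1
      then show ?thesis
        using f(1) simple_graph_edgeD[OF G.simple 1] s(1) by (simp add: local_antimagic_def V_def)
    qed (use s(1,2) ord in \<open>auto simp: V_def\<close>)
  qed (use s ord in \<open>auto simp: V1\<close>)
  moreover have "vertex_sum ?J F' ` verts ?J \<subseteq>
      insert B' (insert C' ((\<lambda>x. x + A') ` vertex_sum G f ` verts G))"
    using s by (auto simp: V1 simp flip: V_def)
  then have "card (vertex_sum ?J F' ` verts ?J) \<le>
      card (insert B' (insert C' ((\<lambda>x. x + A') ` vertex_sum G f ` verts G)))"
    by (rule card_mono[rotated]) (use finV in \<open>simp add: V_def\<close>)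
  then have "card (vertex_sum ?J F' ` verts ?J) \<le> c + 2"
    using f(2) card_image_le[of "vertex_sum G f ` verts G" "\<lambda>x. x + A'"] finV
    by (simp add: card_insert_if V_def split: if_splits)
  ultimately show ?thesis using F'(1) unfolding la_bound_def local_antimagic_def by blast
qed

section \<open>Induction along the iterated join\<close>

theorem theorem3p5:
  fixes G :: "'a ugraph" and Gs :: "nat \<Rightarrow> 'a ugraph" and W :: "nat \<Rightarrow> 'a set"
    and r p :: nat
  assumes "simple_graph G" and "regular_graph G (2 * r)" and "graph_order G = p"
    and "r \<ge> 1" and "p \<ge> 3" and "p - 2 * r \<ge> 2"
    and "enat (chromatic_number G) = chi_la G"
    and "Gs 0 = G"
    and "\<And>k. finite (W k) \<and> card (W k) = p - 2 * r \<and> W k \<inter> verts (Gs k) = {}"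
    and "\<And>k. Gs (Suc k) = graph_join (Gs k) (edgeless_graph (W k))"
  shows "(\<forall>k. simple_graph (Gs (Suc k)) \<and>
            regular_graph (Gs (Suc k)) (2 * r + (k + 1) * (p - 2 * r)) \<and>
            graph_order (Gs (Suc k)) = p + (k + 1) * (p - 2 * r)) \<and>
         (\<forall>k. chi_la (Gs k) = chi_la G + enat k)"
proof -
  define m where "m = p - 2 * r"
  define c where "c = chromatic_number G"
  have p: "p = 2 * r + m" and m2: "m \<ge> 2" using assms(6) by (simp_all add: m_def)
  note W = assms(9)[folded m_def] and Gs = assms(10)
  have inv: "simple_graph (Gs k) \<and> regular_graph (Gs k) (2 * r + k * m) \<and> card (verts (Gs k)) = p + k * m" for k
  proof (induction k)
    case 0
    then show ?case using assms(1-3,8) by (simp add: graph_order_def)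
  next
    case (Suc k)
    interpret edgeless_join "Gs k" "W k" by unfold_locales (use Suc W in auto)
    show ?case using simple_join regular_join[of "2 * r + k * m"] order_join Suc W[of k] p
      by (simp add: Gs algebra_simps)
  qed
  have ej: "edgeless_join (Gs k) (W k)" for k
    by unfold_locales (use inv W in auto)
  have lower: "c + k \<le> chromatic_number (Gs k)" for k
  proof (induction k)
    case 0
    then show ?case by (simp add: c_def assms(8))
  next
    case (Suc k)
    have "W k \<noteq> {}" using W[of k] m2 by auto
    then show ?case using edgeless_join.chromatic_number_join[OF ej[of k]] Suc by (simp add: Gs)
  qed
  have base: "la_bound (Gs 0) c"
    using la_bound_if_chi_la_eq assms(7,8) unfolding c_def by metis
  \<comment> \<open>The parity condition says that the degree \<open>2 * r + k * m\<close> of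
    \<open>Gs k\<close> is even.\<close>
  have one: "la_bound (Gs (Suc k)) (c + Suc k)" if "la_bound (Gs k) (c + k)" "even (k * m)" for k
    using edgeless_join.la_bound_join[OF ej[of k] that(1), of "2 * r + k * m"] inv[of k] W[of k]
      that(2) assms(4) p m2 by (simp add: Gs)
  \<comment> \<open>For odd \<open>m\<close> the degree is even exactly at even indices, which carry
    this induction; an odd index is then reached by one application of \<open>one\<close>.\<close>
  have two: "la_bound (Gs (2 * j)) (c + 2 * j)" if "odd m" for j
  proof (induction j)
    case 0
    then show ?case using base by simp
  next
    case (Suc j)
    have "la_bound (graph_join (graph_join (Gs (2 * j)) (edgeless_graph (W (2 * j)))) (edgeless_graph (W (Suc (2 * j)))))
        (c + 2 * j + 2)"
      by (rule la_bound_join_twice[where d = "2 * r + 2 * j * m" and m = m])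
        (use ej[of "2 * j"] ej[of "Suc (2 * j)"] Suc inv[of "2 * j"] W[of "2 * j"] W[of "Suc (2 * j)"]
          that assms(4) m2 p in \<open>simp_all add: Gs\<close>)
    then show ?case by (simp add: Gs)
  qed
  have upper: "la_bound (Gs k) (c + k)" for k
  proof (cases "even m")
    case True
    then show ?thesis using base one by (induction k) auto
  next
    case False
    show ?thesis
    proof (cases "even k")
      case True
      then show ?thesis using two[OF False] by (auto elim!: evenE)
    next
      case odd: False
      then obtain j where "k = Suc (2 * j)" by (metis oddE Suc_eq_plus1)
      then show ?thesis using one[OF two[OF False, of j]] by simp
    qed
  qed
  have "chi_la (Gs k) = chi_la G + enat k" for k
  proof (rule antisym)
    have eq: "chi_la G + enat k = enat (c + k)" using assms(7) by (metis c_def plus_enat_simps(1))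
    show "chi_la (Gs k) \<le> chi_la G + enat k" using chi_la_le[OF upper[of k]] eq by simp
    have "enat (c + k) \<le> enat (chromatic_number (Gs k))" using lower[of k] by simp
    also have "\<dots> \<le> chi_la (Gs k)" using chromatic_number_le_chi_la inv by blast
    finally show "chi_la G + enat k \<le> chi_la (Gs k)" using eq by simp
  qed
  moreover have "simple_graph (Gs (Suc k)) \<and> regular_graph (Gs (Suc k)) (2 * r + (k + 1) * (p - 2 * r)) \<and>
      graph_order (Gs (Suc k)) = p + (k + 1) * (p - 2 * r)" for k
    using inv[of "Suc k"] by (simp add: graph_order_def flip: m_def)
  ultimately show ?thesis by blast
qed

end
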